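(* Let $i,j$ be real numbers with $0<i,j<1$ and $i+j=1$, and set $\sigma=\min\{i,j\}$. Let $a,b\in\mathbb{R}$ with $a\neq 0$, and let $\mathsf{L}_{a,b}=\{(x,y)\in\mathbb{R}^2: y=ax+b\}$. Suppose there exists $\epsilon>0$ such that $$\liminf_{q\to\infty} q^{\frac{1}{\sigma}-\epsilon}\max\{\|qa\|,\|qb\|\}>0.$$ Then for every $\boldsymbol\theta=(\gamma,\delta)\in\mathbb{R}^2$, the set $\mathrm{Bad}_{\boldsymbol\theta}(i,j)\cap\mathsf{L}_{a,b}$ is a winning subset of $\mathsf{L}_{a,b}$. Moreover, if $a\in\mathbb{Q}$, the same conclusion holds when the displayed condition is assumed with $\epsilon=0$.
   Context: For $t\in\mathbb{R}$, $\|t\|$ denotes the distance from $t$ to the nearest integer. For $\boldsymbol\theta=(\gamma,\delta)\in\mathbb{R}^2$, $\mathrm{Bad}_{\boldsymbol\theta}(i,j)$ is the set of $(x,y)\in\mathbb{R}^2$ for which there is a constant $c(x,y)>0$ with $\max\{\|qx-\gamma\|^{1/i},\|qy-\delta\|^{1/j}\}>c(x,y)\,q^{-1}$ for all $q\in\mathbb{N}$. Schmidt's $(\alpha,\beta)$-game on a space $M$ (here the line $M=\mathsf{L}_{a,b}$ with the metric induced from $\mathbb{R}^2$, played with closed segments/balls of $M$): for $0<\alpha,\beta<1$, player B chooses a closed ball $B_0$; then A chooses a closed ball $A_0\subset B_0$ with $\rho(A_0)=\alpha\rho(B_0)$; then B chooses a closed ball $B_1\subset A_0$ with $\rho(B_1)=\beta\rho(A_0)$,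 and so on alternately, producing nested balls $B_0\supset A_0\supset B_1\supset\cdots$, where $\rho$ denotes diameter. A set $X\subset M$ is $(\alpha,\beta)$-winning if A can play so that the single point $\bigcap_n B_n$ lies in $X$ regardless of how B plays; $\alpha$-winning if $(\alpha,\beta)$-winning for all $\beta\in(0,1)$; winning if $\alpha$-winning for some $\alpha\in(0,1)$. *)

theory Defs
  imports "HOL-Analysis.Analysis"
begin

definition dist_int :: "real \<Rightarrow> real" where
  "dist_int t = infdist t \<int>"

definition Bad :: "real \<times> real \<Rightarrow> real \<Rightarrow> real \<Rightarrow> (real \<times> real) set" where
  "Bad \<theta> i j = {(x, y). \<exists>c>0. \<forall>q::nat. q \<ge> 1 \<longrightarrow>
     max (dist_int (real q * x - fst \<theta>) powr (1 / i))
         (dist_int (real q * y - snd \<theta>) powr (1 / j)) > c / real q}"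

definition plane_line :: "real \<Rightarrow> real \<Rightarrow> (real \<times> real) set" where
  "plane_line a b = {(x, y). y = a * x + b}"

definition closed_balls :: "'a::metric_space set \<Rightarrow> 'a set set" where
  "closed_balls M = {M \<inter> cball x r | x r. x \<in> M \<and> r > 0}"

text \<open>A strategy for player A maps the list \<open>[B 0, \<dots>, B n]\<close> of the moves made so far by
  player B to the ball \<open>A n\<close>. (The earlier moves of A are determined by the strategy.)\<close>

definition A_move :: "('a set list \<Rightarrow> 'a set) \<Rightarrow> (nat \<Rightarrow> 'a set) \<Rightarrow> nat \<Rightarrow> 'a set" where
  "A_move s B n = s (map B [0..<Suc n])"

definition legal_B_upto ::
  "'a::metric_space set \<Rightarrow> real \<Rightarrow> ('a set list \<Rightarrow> 'a set) \<Rightarrow> (nat \<Rightarrow> 'a set) \<Rightarrow> nat \<Rightarrow> bool" where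
  "legal_B_upto M \<beta> s B n \<longleftrightarrow> B 0 \<in> closed_balls M \<and>
     (\<forall>k<n. B (Suc k) \<in> closed_balls M \<and> B (Suc k) \<subseteq> A_move s B k \<and>
            diameter (B (Suc k)) = \<beta> * diameter (A_move s B k))"

text \<open>Legality of the moves of A is required after every finite legal initial part of a play.
  Requiring it only along infinite plays would let A win by an illegal move that leaves B without
  an answer.\<close>

definition legal_strategy ::
  "'a::metric_space set \<Rightarrow> real \<Rightarrow> real \<Rightarrow> ('a set list \<Rightarrow> 'a set) \<Rightarrow> bool" where
  "legal_strategy M \<alpha> \<beta> s \<longleftrightarrow> (\<forall>B n. legal_B_upto M \<beta> s B n \<longrightarrow>
     A_move s B n \<in> closed_balls M \<and> A_move s B n \<subseteq> B n \<and>
     diameter (A_move s B n) = \<alpha> * diameter (B n))"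

definition ab_winning :: "'a::metric_space set \<Rightarrow> real \<Rightarrow> real \<Rightarrow> 'a set \<Rightarrow> bool" where
  "ab_winning M \<alpha> \<beta> X \<longleftrightarrow> (\<exists>s. legal_strategy M \<alpha> \<beta> s \<and>
     (\<forall>B. (\<forall>n. legal_B_upto M \<beta> s B n) \<longrightarrow> (\<exists>x\<in>X. (\<Inter>n. B n) = {x})))"

definition alpha_winning :: "'a::metric_space set \<Rightarrow> real \<Rightarrow> 'a set \<Rightarrow> bool" where
  "alpha_winning M \<alpha> X \<longleftrightarrow> (\<forall>\<beta>. 0 < \<beta> \<and> \<beta> < 1 \<longrightarrow> ab_winning M \<alpha> \<beta> X)"

definition winning :: "'a::metric_space set \<Rightarrow> 'a set \<Rightarrow> bool" where
  "winning M X \<longleftrightarrow> X \<subseteq> M \<and> (\<exists>\<alpha>. 0 < \<alpha> \<and> \<alpha> < 1 \<and> alpha_winning M \<alpha> X)"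

end

theory Submission
  imports Defs
begin

text \<open>
  By symmetry let \<open>j \<le> i\<close>, and parametrise the line by \<open>x\<close>. Every rational point
  \<open>(p/q, r/q)\<close> lies on a rational line \<open>A x + B y + C = 0\<close> with \<open>\<bar>A\<bar> \<le> q\<^sup>i\<close> and
  \<open>\<bar>B\<bar> \<le> q\<^sup>j\<close>. If it is dangerously close to \<open>(x, a x + b)\<close>, then \<open>x\<close> lies within
  about \<open>c / (q D)\<close> of the intersection of that line with \<open>y = a x + b\<close>, where
  \<open>D = \<bar>A + a B\<bar>\<close>; the Diophantine condition on \<open>(a, b)\<close> keeps \<open>D\<close> above
  \<open>q\<^bsup>\<epsilon>-1\<^esup>\<close>. Group the points by the size of \<open>q D\<close> and of \<open>T = q\<^sup>i / D\<close>. All points of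
  one group that threaten a suitable interval share the same line, so they are covered by one short
  interval. For bounded \<open>T\<close> this holds because an integer of modulus less than 1 vanishes. For large
  \<open>T\<close> it holds even in an interval longer by a power of \<open>T\<close>, since otherwise the
  intersection of two lines would be a rational point of much smaller height that was avoided
  earlier. Hence the dangerous intervals that have to be taken into account at one stage have
  geometrically decreasing relative lengths, and player A avoids all of them by always moving to the
  quarter of smaller potential. Once the homogeneous points are avoided, two inhomogeneous ones of
  comparable height cannot threaten the same short interval (consider their difference), so they are
  avoided in the same play.
\<close>

section \<open>A potential strategy on intervals\<close>

text \<open>The delay 7 is the least \<^term>\<open>d\<close> with \<^prop>\<open>1/2 + 3 * (2/3 :: real) ^ (d + 1) \<le> 2/3\<close>, the
  inequality behind the induction step of \<open>potential_less_power\<close>.\<close>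

definition deadline :: "nat \<Rightarrow> nat \<Rightarrow> nat" where
  "deadline k m = k + 7 + m"

definition stage_potential :: "(nat \<Rightarrow> nat \<Rightarrow> 'a set) \<Rightarrow> nat \<Rightarrow> 'a set \<Rightarrow> real" where
  "stage_potential E k K = (\<Sum>m. (2/3) ^ deadline k m * of_bool (E k m \<inter> K \<noteq> {}))"

definition potential :: "(nat \<Rightarrow> nat \<Rightarrow> 'a set) \<Rightarrow> nat \<Rightarrow> 'a set \<Rightarrow> real" where
  "potential E n K = (\<Sum>k\<le>n. stage_potential E k K)"

definition cleared :: "(nat \<Rightarrow> nat \<Rightarrow> 'a set) \<Rightarrow> nat \<Rightarrow> 'a set \<Rightarrow> bool" where
  "cleared E n K \<longleftrightarrow> (\<forall>k m. deadline k m \<le> n \<longrightarrow> E k m \<inter> K = {})"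

definition better_quarter :: "(nat \<Rightarrow> nat \<Rightarrow> real set) \<Rightarrow> nat \<Rightarrow> real \<Rightarrow> real \<Rightarrow> real" where
  "better_quarter E n u h =
     (if potential E n {u..u + h/4} \<le> potential E n {u + 3*h/4..u + 3*h/4 + h/4}
      then u else u + 3*h/4)"

definition isolating :: "real \<Rightarrow> real \<Rightarrow> real \<Rightarrow> (nat \<Rightarrow> nat \<Rightarrow> real set) \<Rightarrow> bool" where
  "isolating u l \<eta> E \<longleftrightarrow> (\<forall>n m v. {v..v + l * \<eta> ^ n} \<subseteq> {u..u + l} \<longrightarrow>
     cleared E n {v..v + l * \<eta> ^ n} \<longrightarrow>
     (\<forall>x \<in> E n m \<inter> {v..v + l * \<eta> ^ n}. \<forall>y \<in> E n m \<inter> {v..v + l * \<eta> ^ n}.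
        \<bar>x - y\<bar> \<le> l * \<eta> ^ deadline n m))"

lemma sums_geometric_deadline: "(\<lambda>m. (2/3::real) ^ deadline k m) sums (3 * (2/3) ^ (k + 7))"
  using sums_mult[OF geometric_sums[of "2/3::real"], of "(2/3) ^ (k + 7)"]
  by (simp add: deadline_def power_add mult_ac)

lemma summable_stage_potential: "summable (\<lambda>m. (2/3::real) ^ deadline k m * of_bool (P m))"
  by (rule summable_comparison_test'[OF sums_summable[OF sums_geometric_deadline[of k]], of 0]) auto

lemma stage_potential_nonneg: "0 \<le> stage_potential E k K"
  unfolding stage_potential_def by (intro suminf_nonneg summable_stage_potential) auto

lemma stage_potential_le: "stage_potential E k K \<le> 3 * (2/3) ^ (k + 7)"
proof -
  have "stage_potential E k K \<le> (\<Sum>m. (2/3) ^ deadline k m)"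
    unfolding stage_potential_def
    by (intro suminf_le summable_stage_potential sums_summable[OF sums_geometric_deadline]) auto
  then show ?thesis using sums_unique[OF sums_geometric_deadline[of k]] by simp
qed

lemma stage_potential_mono: "K \<subseteq> K' \<Longrightarrow> stage_potential E k K \<le> stage_potential E k K'"
  unfolding stage_potential_def
  by (intro suminf_le summable_stage_potential) (auto simp: of_bool_def)

lemma stage_potential_add_le:
  assumes "\<And>m. E k m \<inter> K1 = {} \<or> E k m \<inter> K2 = {}"
  shows "stage_potential E k K1 + stage_potential E k K2 \<le> stage_potential E k (K1 \<union> K2)"
  unfolding stage_potential_def suminf_add[OF summable_stage_potential summable_stage_potential]
proof (intro suminf_le summable_add summable_stage_potential)
  show "(2/3) ^ deadline k m * of_bool (E k m \<inter> K1 \<noteq> {}) +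
      (2/3) ^ deadline k m * of_bool (E k m \<inter> K2 \<noteq> {})
      \<le> (2/3::real) ^ deadline k m * of_bool (E k m \<inter> (K1 \<union> K2) \<noteq> {})" for m
    using assms[of m] by (auto simp: of_bool_def)
qed

lemma power_deadline_le_stage_potential:
  assumes "E k m \<inter> K \<noteq> {}"
  shows "(2/3) ^ deadline k m \<le> stage_potential E k K"
  using sum_le_suminf[OF summable_stage_potential[of k "\<lambda>m. E k m \<inter> K \<noteq> {}"], of "{m}"] assms
  by (simp add: stage_potential_def)

lemma potential_mono: "K \<subseteq> K' \<Longrightarrow> potential E n K \<le> potential E n K'"
  unfolding potential_def by (intro sum_mono stage_potential_mono)

lemma potential_Suc_le: "potential E (Suc n) K \<le> potential E n K + 3 * (2/3) ^ (n + 8)"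
  using stage_potential_le[of E "Suc n" K] by (simp add: potential_def add.commute)

lemma cleared_of_potential_less:
  assumes "potential E n K < (2/3) ^ n"
  shows "cleared E n K"
  unfolding cleared_def
proof (intro allI impI, rule ccontr)
  fix k m assume deadline_le: "deadline k m \<le> n" and "E k m \<inter> K \<noteq> {}"
  then have "(2/3) ^ deadline k m \<le> stage_potential E k K"
    by (intro power_deadline_le_stage_potential)
  also have "\<dots> \<le> potential E n K"
    unfolding potential_def using deadline_le
    by (intro member_le_sum stage_potential_nonneg) (auto simp: deadline_def)
  also have "\<dots> < (2/3) ^ n" by (rule assms)
  also have "\<dots> \<le> (2/3) ^ deadline k m" using deadline_le by (intro power_decreasing) auto
  finally show False by simp
qed

lemma potential_better_quarter_le:
  assumes "h > 0"
    and "\<And>k m. k \<le> n \<Longrightarrow>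
      E k m \<inter> {u..u + h/4} = {} \<or> E k m \<inter> {u + 3*h/4..u + 3*h/4 + h/4} = {}"
  shows "2 * potential E n {better_quarter E n u h..better_quarter E n u h + h/4}
    \<le> potential E n {u..u + h}"
proof -
  let ?K1 = "{u..u + h/4}" and ?K2 = "{u + 3*h/4..u + 3*h/4 + h/4}"
  have "potential E n ?K1 + potential E n ?K2 \<le> potential E n (?K1 \<union> ?K2)"
    unfolding potential_def sum.distrib[symmetric]
    using assms(2) by (intro sum_mono stage_potential_add_le) auto
  also have "\<dots> \<le> potential E n {u..u + h}" using assms(1) by (intro potential_mono) auto
  finally show ?thesis by (auto simp: better_quarter_def)
qed

lemma better_quarter_subset:
  "h > 0 \<Longrightarrow> {better_quarter E n u h..better_quarter E n u h + h/4} \<subseteq> {u..u + h}"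
  by (auto simp: better_quarter_def)

locale better_quarter_play =
  fixes E :: "nat \<Rightarrow> nat \<Rightarrow> real set" and u :: "nat \<Rightarrow> real" and l \<eta> :: real
  assumes l_pos: "l > 0" and \<eta>_bounds: "0 < \<eta>" "\<eta> \<le> 1/4"
    and isolating: "isolating (u 0) l \<eta> E"
    and moves: "\<And>n. {u (Suc n)..u (Suc n) + l * \<eta> ^ Suc n}
      \<subseteq> (let v = better_quarter E n (u n) (l * \<eta> ^ n) in {v..v + l * \<eta> ^ n / 4})"
begin

abbreviation J :: "nat \<Rightarrow> real set" where
  "J n \<equiv> {u n..u n + l * \<eta> ^ n}"

lemma J_antimono:
  assumes "k \<le> n"
  shows "J n \<subseteq> J k"
proof (rule lift_Suc_antimono_le[OF _ assms])
  show "J (Suc n) \<subseteq> J n" for n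
    using moves[of n] better_quarter_subset[of "l * \<eta> ^ n" E n "u n"] l_pos \<eta>_bounds
    by (simp add: Let_def)
qed

lemma misses_a_quarter:
  assumes cleared: "\<And>q. q \<le> n \<Longrightarrow> cleared E q (J q)" and "k \<le> n" and h_eq: "h = l * \<eta> ^ n"
  shows "E k m \<inter> {u n..u n + h/4} = {} \<or> E k m \<inter> {u n + 3*h/4..u n + 3*h/4 + h/4} = {}"
proof (rule ccontr)
  assume "\<not> ?thesis"
  then obtain x y where mem: "x \<in> E k m" "x \<in> {u n..u n + h/4}"
    "y \<in> E k m" "y \<in> {u n + 3*h/4..u n + 3*h/4 + h/4}" by blast
  have h_pos: "h > 0" using h_eq l_pos \<eta>_bounds by simp
  then have mem_interval: "x \<in> J n" "y \<in> J n" using mem h_eq by auto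
  then have late: "n < deadline k m"
    using cleared[of n] mem(1) unfolding cleared_def by (metis disjoint_iff le_refl not_le)
  have "{u k..u k + l * \<eta> ^ k} \<subseteq> {u 0..u 0 + l}" using J_antimono[of 0 k] by simp
  then have "\<bar>x - y\<bar> \<le> l * \<eta> ^ deadline k m"
    using isolating cleared[OF \<open>k \<le> n\<close>] J_antimono[OF \<open>k \<le> n\<close>] mem_interval mem
    unfolding isolating_def by blast
  also have "\<dots> \<le> l * \<eta> ^ Suc n"
    using l_pos \<eta>_bounds late by (intro mult_left_mono power_decreasing) auto
  also have "\<dots> \<le> h / 4"
    using mult_right_mono[of \<eta> "1/4" h] \<eta>_bounds h_pos h_eq by (simp add: mult_ac)
  finally show False using mem h_pos by auto
qed

text \<open>The weight of a set reaches the threshold exactly at its deadline, so by then the set has been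
  left behind; before the deadline it is too short to meet both quarters.\<close>

lemma potential_less_power: "potential E n (J n) < (2/3) ^ n"
proof (induction n rule: less_induct)
  case (less n)
  show ?case
  proof (cases n)
    case 0
    have "potential E 0 (J 0) \<le> 3 * (2/3) ^ 7"
      using stage_potential_le[of E 0 "J 0"] by (simp add: potential_def)
    also have "\<dots> < (1::real)" by (simp add: power_divide)
    finally show ?thesis using 0 by simp
  next
    case (Suc p)
    let ?h = "l * \<eta> ^ p"
    let ?v = "better_quarter E p (u p) ?h"
    have "cleared E q (J q)" if "q \<le> p" for q
      using less.IH[of q] that Suc by (intro cleared_of_potential_less) simp
    then have "2 * potential E p {?v..?v + ?h/4} \<le> potential E p (J p)"
      using l_pos \<eta>_bounds misses_a_quarter[of p] by (intro potential_better_quarter_le) auto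
    also have "\<dots> < (2/3) ^ p" using less.IH[of p] Suc by simp
    finally have half: "potential E p {?v..?v + ?h/4} < (2/3) ^ p / 2" by simp
    have "potential E n (J n) \<le> potential E p (J n) + 3 * (2/3) ^ (p + 8)"
      using potential_Suc_le[of E p "J n"] Suc by simp
    also have "\<dots> < (2/3) ^ p / 2 + 3 * (2/3) ^ (p + 8)"
      using potential_mono[OF moves[of p], of E p] half Suc by (simp add: Let_def)
    also have "\<dots> \<le> (2/3) ^ n"
      using zero_less_power[of "2/3::real" p]
      unfolding Suc power_add power_Suc by (simp add: eval_nat_numeral)
    finally show ?thesis .
  qed
qed

lemma limit_notin:
  assumes "\<And>n. x \<in> J n"
  shows "x \<notin> E k m"
  using cleared_of_potential_less[OF potential_less_power[of "deadline k m"]]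
    assms[of "deadline k m"] unfolding cleared_def by blast

end

section \<open>Schmidt's game on a line\<close>

lemma nested_intervals_singleton:
  fixes u :: "nat \<Rightarrow> real" and l \<eta> :: real
  assumes "l > 0" "0 < \<eta>" "\<eta> < 1"
    and nested: "\<And>n. {u (Suc n)..u (Suc n) + l * \<eta> ^ Suc n} \<subseteq> {u n..u n + l * \<eta> ^ n}"
  obtains x where "(\<Inter>n. {u n..u n + l * \<eta> ^ n}) = {x}"
proof -
  define K where "K n = {u n..u n + l * \<eta> ^ n}" for n
  have "\<exists>x. \<Inter>(range K) = {x}"
  proof (rule decreasing_closed_nest_sing)
    show "closed (K n)" for n by (simp add: K_def)
    show "K n \<noteq> {}" for n using assms by (simp add: K_def)
    show "K n \<subseteq> K m" if "m \<le> n" for m n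
      using lift_Suc_antimono_le[of K, OF _ that] nested unfolding K_def .
    show "\<exists>n. \<forall>x\<in>K n. \<forall>y\<in>K n. dist x y < e" if "e > 0" for e
    proof -
      have "0 < e / l" using that assms(1) by simp
      then obtain n where "\<eta> ^ n < e / l" using real_arch_pow_inv assms(3) by blast
      then have "l * \<eta> ^ n < e" using assms by (simp add: field_simps)
      then show ?thesis by (intro exI[of _ n]) (auto simp: K_def dist_real_def)
    qed
  qed
  then show ?thesis using that unfolding K_def by blast
qed

locale affine_line =
  fixes p w :: "'a::real_normed_vector"
  assumes direction: "w \<noteq> 0"
begin

definition point :: "real \<Rightarrow> 'a" where
  "point t = p + t *\<^sub>R w"

definition width :: "'a set \<Rightarrow> real" where
  "width B = diameter B / norm w"

definition left_end :: "'a set \<Rightarrow> real" where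
  "left_end B = Inf (point -` B)"

lemma inj_point: "inj point"
  using direction by (auto simp: inj_def point_def)

lemma dist_point: "dist (point s) (point t) = norm w * \<bar>s - t\<bar>"
  by (simp add: point_def dist_norm flip: scaleR_diff_left)

lemma closed_ball_eq_segment:
  "range point \<inter> cball (point t) (norm w * r) = point ` {t - r..t + r}"
proof -
  have "point s \<in> cball (point t) (norm w * r) \<longleftrightarrow> s \<in> {t - r..t + r}" for s
    using direction by (auto simp: dist_point abs_le_iff)
  then show ?thesis by blast
qed

lemma closed_balls_iff:
  "B \<in> closed_balls (range point) \<longleftrightarrow> (\<exists>u h. h > 0 \<and> B = point ` {u..u + h})"
proof
  assume "B \<in> closed_balls (range point)"
  then obtain t r where "r > 0" "B = range point \<inter> cball (point t) (norm w * (r / norm w))"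
    using direction unfolding closed_balls_def by auto
  then show "\<exists>u h. h > 0 \<and> B = point ` {u..u + h}"
    unfolding closed_ball_eq_segment using direction
    by (intro exI[of _ "t - r / norm w"] exI[of _ "2 * r / norm w"]) auto
next
  assume "\<exists>u h. h > 0 \<and> B = point ` {u..u + h}"
  then obtain u h where segment: "h > 0" "B = point ` {u..u + h}" by blast
  then have "B = range point \<inter> cball (point (u + h/2)) (norm w * (h/2))"
    unfolding closed_ball_eq_segment by (simp add: add.commute)
  moreover have "norm w * (h/2) > 0" using segment direction by simp
  ultimately show "B \<in> closed_balls (range point)" unfolding closed_balls_def by blast
qed

lemma diameter_segment:
  assumes "h \<ge> 0"
  shows "diameter (point ` {u..u + h}) = norm w * h"
proof (rule antisym)
  show "diameter (point ` {u..u + h}) \<le> norm w * h"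
    using assms by (intro diameter_le)
      (auto simp: dist_point simp flip: dist_norm intro!: mult_left_mono)
  have "compact (point ` {u..u + h})"
    unfolding point_def by (intro compact_continuous_image continuous_intros) auto
  then have "dist (point u) (point (u + h)) \<le> diameter (point ` {u..u + h})"
    using assms by (intro diameter_bounded_bound compact_imp_bounded) auto
  then show "norm w * h \<le> diameter (point ` {u..u + h})" using assms by (simp add: dist_point)
qed

lemma width_segment: "h \<ge> 0 \<Longrightarrow> width (point ` {u..u + h}) = h"
  using direction by (simp add: width_def diameter_segment)

lemma left_end_segment: "h \<ge> 0 \<Longrightarrow> left_end (point ` {u..u + h}) = u"
  by (simp add: left_end_def inj_vimage_image_eq[OF inj_point])

lemma closed_ball_decompose:
  assumes "B \<in> closed_balls (range point)"
  shows "width B > 0" and "B = point ` {left_end B..left_end B + width B}"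
  using assms by (auto simp: closed_balls_iff width_segment left_end_segment)

text \<open>The first move of player B is passed to \<^term>\<open>f\<close> because the family of sets to be avoided
  depends on it.\<close>

definition interval_strategy ::
  "(real \<Rightarrow> real \<Rightarrow> nat \<Rightarrow> real \<Rightarrow> real \<Rightarrow> real) \<Rightarrow> real \<Rightarrow> 'a set list \<Rightarrow> 'a set" where
  "interval_strategy f \<alpha> Bs =
     (let B0 = hd Bs; B = last Bs;
          v = f (left_end B0) (width B0) (length Bs - 1) (left_end B) (width B)
      in point ` {v..v + \<alpha> * width B})"

lemma A_move_interval_strategy:
  "A_move (interval_strategy f \<alpha>) B n =
     (let v = f (left_end (B 0)) (width (B 0)) n (left_end (B n)) (width (B n))
      in point ` {v..v + \<alpha> * width (B n)})"
proof -
  have "hd (map B [0..<Suc n]) = B 0" by (simp add: hd_map hd_upt del: upt_Suc)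
  then show ?thesis by (simp add: A_move_def interval_strategy_def Let_def)
qed

lemma legal_B_upto_closed_ball:
  "legal_B_upto M \<beta> s B n \<Longrightarrow> B n \<in> closed_balls M"
  unfolding legal_B_upto_def by (cases n) auto

lemma legal_interval_strategy:
  assumes "\<alpha> > 0" and fits: "\<And>u0 l n u h. h > 0 \<Longrightarrow>
      {f u0 l n u h..f u0 l n u h + \<alpha> * h} \<subseteq> {u..u + h}"
  shows "legal_strategy (range point) \<alpha> \<beta> (interval_strategy f \<alpha>)"
  unfolding legal_strategy_def
proof (intro allI impI)
  fix B n assume "legal_B_upto (range point) \<beta> (interval_strategy f \<alpha>) B n"
  then have ball: "B n \<in> closed_balls (range point)" by (rule legal_B_upto_closed_ball)
  note B_eq = closed_ball_decompose[OF ball]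
  define v where "v = f (left_end (B 0)) (width (B 0)) n (left_end (B n)) (width (B n))"
  have A_eq: "A_move (interval_strategy f \<alpha>) B n = point ` {v..v + \<alpha> * width (B n)}"
    by (simp add: A_move_interval_strategy v_def Let_def)
  have "point ` {v..v + \<alpha> * width (B n)} \<subseteq> B n"
    unfolding v_def by (subst (4) B_eq(2)) (intro image_mono fits B_eq(1))
  moreover have "\<alpha> * width (B n) > 0" using B_eq(1) \<open>\<alpha> > 0\<close> by simp
  moreover have "norm w * (\<alpha> * width (B n)) = \<alpha> * diameter (B n)"
    using direction by (simp add: width_def)
  ultimately show "A_move (interval_strategy f \<alpha>) B n \<in> closed_balls (range point) \<and>
      A_move (interval_strategy f \<alpha>) B n \<subseteq> B n \<and>
      diameter (A_move (interval_strategy f \<alpha>) B n) = \<alpha> * diameter (B n)"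
    unfolding A_eq closed_balls_iff by (auto simp: diameter_segment less_imp_le)
qed

lemma width_interval_play:
  assumes "\<alpha> > 0" "\<And>n. legal_B_upto (range point) \<beta> (interval_strategy f \<alpha>) B n"
  shows "width (B n) = width (B 0) * (\<alpha> * \<beta>) ^ n"
proof (induction n)
  case (Suc n)
  have "B n \<in> closed_balls (range point)" using assms(2) by (rule legal_B_upto_closed_ball)
  then have "width (A_move (interval_strategy f \<alpha>) B n) = \<alpha> * width (B n)"
    using \<open>\<alpha> > 0\<close> closed_ball_decompose(1)[of "B n"]
    by (simp add: A_move_interval_strategy width_segment Let_def)
  moreover have "width (B (Suc n)) = \<beta> * width (A_move (interval_strategy f \<alpha>) B n)"
    using assms(2)[of "Suc n"] unfolding legal_B_upto_def by (simp add: width_def)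
  ultimately show ?case using Suc by simp
qed simp

lemma interval_play_segments:
  assumes "\<alpha> > 0" and legal: "\<And>n. legal_B_upto (range point) \<beta> (interval_strategy f \<alpha>) B n"
    and u_eq: "\<And>n. u n = left_end (B n)" and l_eq: "l = width (B 0)"
  shows "B n = point ` {u n..u n + l * (\<alpha> * \<beta>) ^ n}"
    and "{u (Suc n)..u (Suc n) + l * (\<alpha> * \<beta>) ^ Suc n} \<subseteq>
      (let v = f (u 0) l n (u n) (l * (\<alpha> * \<beta>) ^ n) in {v..v + \<alpha> * (l * (\<alpha> * \<beta>) ^ n)})"
proof -
  have B_eq: "B n = point ` {u n..u n + l * (\<alpha> * \<beta>) ^ n}" for n
    using closed_ball_decompose(2)[OF legal_B_upto_closed_ball[OF legal], of n]
      width_interval_play[OF assms(1) legal, of n]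
    by (simp add: u_eq l_eq)
  then show "B n = point ` {u n..u n + l * (\<alpha> * \<beta>) ^ n}" .
  have "B (Suc n) \<subseteq> A_move (interval_strategy f \<alpha>) B n"
    using legal[of "Suc n"] unfolding legal_B_upto_def by blast
  then show "{u (Suc n)..u (Suc n) + l * (\<alpha> * \<beta>) ^ Suc n} \<subseteq>
      (let v = f (u 0) l n (u n) (l * (\<alpha> * \<beta>) ^ n) in {v..v + \<alpha> * (l * (\<alpha> * \<beta>) ^ n)})"
    unfolding B_eq[of "Suc n"] A_move_interval_strategy Let_def
      width_interval_play[OF assms(1) legal, of n] l_eq[symmetric] u_eq[symmetric]
    by (simp add: inj_image_subset_iff[OF inj_point])
qed

lemma ab_winning_interval_strategyI:
  assumes "0 < \<alpha>" "\<alpha> < 1" "0 < \<beta>" "\<beta> < 1"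
    and fits: "\<And>u0 l n u h. h > 0 \<Longrightarrow> {f u0 l n u h..f u0 l n u h + \<alpha> * h} \<subseteq> {u..u + h}"
    and wins: "\<And>u l x. \<lbrakk>l > 0;
        \<And>n. {u (Suc n)..u (Suc n) + l * (\<alpha> * \<beta>) ^ Suc n} \<subseteq>
          (let v = f (u 0) l n (u n) (l * (\<alpha> * \<beta>) ^ n) in {v..v + \<alpha> * (l * (\<alpha> * \<beta>) ^ n)});
        \<And>n. x \<in> {u n..u n + l * (\<alpha> * \<beta>) ^ n}\<rbrakk> \<Longrightarrow> point x \<in> X"
  shows "ab_winning (range point) \<alpha> \<beta> X"
  unfolding ab_winning_def
proof (intro exI conjI allI impI)
  show "legal_strategy (range point) \<alpha> \<beta> (interval_strategy f \<alpha>)"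
    using assms(1) fits by (rule legal_interval_strategy)
next
  fix B assume "\<forall>n. legal_B_upto (range point) \<beta> (interval_strategy f \<alpha>) B n"
  then have legal: "legal_B_upto (range point) \<beta> (interval_strategy f \<alpha>) B n" for n by blast
  define u where "u n = left_end (B n)" for n
  define l where "l = width (B 0)"
  define K where "K n = {u n..u n + l * (\<alpha> * \<beta>) ^ n}" for n
  have l_pos: "l > 0"
    unfolding l_def using legal_B_upto_closed_ball[OF legal] by (rule closed_ball_decompose)
  note segments = interval_play_segments[OF assms(1) legal u_def l_def, folded K_def]
  have "\<alpha> * \<beta> < 1" using mult_strict_mono[of \<alpha> 1 \<beta> 1] assms by simp
  moreover have "K (Suc n) \<subseteq> K n" for n
    unfolding K_def[of n] using l_pos assms(1,3)
    by (intro order.trans[OF segments(2)[unfolded Let_def] fits]) simp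
  ultimately obtain x where Inter_eq: "(\<Inter>n. K n) = {x}"
    using nested_intervals_singleton[of l "\<alpha> * \<beta>" u] l_pos assms unfolding K_def by auto
  then have "x \<in> K n" for n by blast
  then have "point x \<in> X" using l_pos segments(2) unfolding K_def by (intro wins[of l u])
  moreover have "(\<Inter>n. B n) = {point x}"
    unfolding segments(1) using Inter_eq image_INT[OF inj_point, of UNIV K] by auto
  ultimately show "\<exists>x\<in>X. (\<Inter>n. B n) = {x}" by blast
qed

lemma alpha_winning_of_isolating:
  assumes "\<And>\<beta> u l. 0 < \<beta> \<Longrightarrow> \<beta> < 1 \<Longrightarrow> l > 0 \<Longrightarrow>
      \<exists>E. isolating u l (\<beta>/4) E \<and> (\<forall>x\<in>{u..u + l}. (\<forall>k m. x \<notin> E k m) \<longrightarrow> point x \<in> X)"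
  shows "alpha_winning (range point) (1/4) X"
  unfolding alpha_winning_def
proof (intro allI impI)
  fix \<beta> :: real assume \<beta>_bounds: "0 < \<beta> \<and> \<beta> < 1"
  then have "\<forall>u l. \<exists>E. l > 0 \<longrightarrow> isolating u l (\<beta>/4) E \<and>
      (\<forall>x\<in>{u..u + l}. (\<forall>k m. x \<notin> E k m) \<longrightarrow> point x \<in> X)"
    using assms by blast
  then obtain E where E_avoids: "\<forall>u l. l > 0 \<longrightarrow> isolating u l (\<beta>/4) (E u l) \<and>
      (\<forall>x\<in>{u..u + l}. (\<forall>k m. x \<notin> E u l k m) \<longrightarrow> point x \<in> X)"
    by metis
  show "ab_winning (range point) (1/4) \<beta> X"
  proof (rule ab_winning_interval_strategyI)
    show "{better_quarter (E u0 l) n u h..better_quarter (E u0 l) n u h + 1/4 * h} \<subseteq> {u..u + h}"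
      if "h > 0" for u0 l n u h
      using better_quarter_subset[OF that, of "E u0 l" n u] by simp
  next
    fix u :: "nat \<Rightarrow> real" and l x :: real
    assume l_pos: "l > 0"
      and moves: "\<And>n. {u (Suc n)..u (Suc n) + l * (1/4 * \<beta>) ^ Suc n} \<subseteq>
        (let v = better_quarter (E (u 0) l) n (u n) (l * (1/4 * \<beta>) ^ n)
         in {v..v + 1/4 * (l * (1/4 * \<beta>) ^ n)})"
      and mem: "\<And>n. x \<in> {u n..u n + l * (1/4 * \<beta>) ^ n}"
    interpret better_quarter_play "E (u 0) l" u l "\<beta>/4"
      using l_pos \<beta>_bounds E_avoids moves by unfold_locales (simp_all add: Let_def)
    have "x \<in> {u 0..u 0 + l}" using mem[of 0] by simp
    moreover have "x \<notin> E (u 0) l k m" for k m using mem by (intro limit_notin) simp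
    ultimately show "point x \<in> X" using E_avoids l_pos by blast
  qed (use \<beta>_bounds in auto)
qed

end

section \<open>The Diophantine condition\<close>

lemma dist_int_nonneg: "0 \<le> dist_int t"
  by (simp add: dist_int_def infdist_nonneg)

lemma dist_int_le: "dist_int t \<le> \<bar>t - of_int m\<bar>"
  unfolding dist_int_def using infdist_le[of "of_int m" "\<int>" t] by (simp add: dist_real_def)

lemma dist_int_eq_0_iff: "dist_int t = 0 \<longleftrightarrow> t \<in> \<int>"
  unfolding dist_int_def using in_closed_iff_infdist_zero[of "\<int>" t] Ints_0 closed_Ints by blast

lemma dist_int_attained:
  obtains m :: int where "dist_int t = \<bar>t - of_int m\<bar>"
proof -
  obtain x where "x \<in> (\<int>::real set)" "infdist t \<int> = dist t x"
    using infdist_attains_inf[of "\<int>::real set" t] Ints_0 closed_Ints by blast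
  then show ?thesis by (metis Ints_cases dist_int_def dist_real_def that)
qed

lemma dist_int_abs_mult_le:
  fixes B C :: int
  shows "dist_int (real_of_int \<bar>B\<bar> * s) \<le> \<bar>of_int B * s + of_int C\<bar>"
  using dist_int_le[of "of_int \<bar>B\<bar> * s" "- sgn B * C"]
  by (cases "B \<ge> 0") (auto simp: sgn_if abs_minus_commute split: if_splits)

lemma liminf_pos_imp_lower_bound:
  fixes f :: "nat \<Rightarrow> real"
  assumes lim: "liminf (\<lambda>n. ereal (f n)) > 0" and pos: "\<And>n. n \<ge> 1 \<Longrightarrow> f n > 0"
  obtains \<kappa> where "\<kappa> > 0" "\<And>n. n \<ge> 1 \<Longrightarrow> \<kappa> \<le> f n"
proof -
  obtain y where y_bounds: "0 < y" "ereal y < liminf (\<lambda>n. ereal (f n))"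
    using ereal_dense2[OF lim] by auto
  then obtain N where eventually_gt: "\<And>n. n \<ge> N \<Longrightarrow> y < f n"
    using less_LiminfD[OF y_bounds(2)] unfolding eventually_sequentially by auto
  define \<kappa> where "\<kappa> = Min (insert y (f ` {1..N}))"
  have "\<kappa> > 0" unfolding \<kappa>_def using y_bounds(1) pos by (subst Min_gr_iff) auto
  moreover have "\<kappa> \<le> f n" if "n \<ge> 1" for n
  proof (cases "n \<le> N")
    case True
    then show ?thesis unfolding \<kappa>_def using that by (intro Min_le) auto
  next
    case False
    have "\<kappa> \<le> y" unfolding \<kappa>_def by (intro Min_le) auto
    then show ?thesis using eventually_gt[of n] False by simp
  qed
  ultimately show ?thesis by (rule that)
qed

definition joint_dist_int :: "real \<Rightarrow> real \<Rightarrow> nat \<Rightarrow> real" where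
  "joint_dist_int a b n = max (dist_int (real n * a)) (dist_int (real n * b))"

lemma joint_dist_int_nonneg: "0 \<le> joint_dist_int a b n"
  by (simp add: joint_dist_int_def le_max_iff_disj dist_int_nonneg)

lemma joint_dist_int_eq_0_iff: "joint_dist_int a b n = 0 \<longleftrightarrow> real n * a \<in> \<int> \<and> real n * b \<in> \<int>"
  using dist_int_nonneg[of "real n * a"] dist_int_nonneg[of "real n * b"]
  unfolding joint_dist_int_def dist_int_eq_0_iff[symmetric] by linarith

lemma joint_dist_int_pos_of_liminf:
  fixes \<tau> :: real
  assumes "liminf (\<lambda>n. ereal (real n powr \<tau> * joint_dist_int a b n)) > 0" and "n \<ge> 1"
  shows "joint_dist_int a b n > 0"
proof (rule ccontr)
  assume "\<not> ?thesis"
  then have "joint_dist_int a b n = 0" using joint_dist_int_nonneg[of a b n] by linarith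
  then have "real n * a \<in> \<int>" "real n * b \<in> \<int>" by (simp_all add: joint_dist_int_eq_0_iff)
  then have zero: "joint_dist_int a b (k * n) = 0" for k
    by (simp add: joint_dist_int_eq_0_iff mult.assoc)
  obtain N where eventually_pos: "\<And>m. m \<ge> N \<Longrightarrow> 0 < real m powr \<tau> * joint_dist_int a b m"
    using less_LiminfD[OF assms(1)] unfolding eventually_sequentially by auto
  have "N \<le> N * n" using assms(2) by simp
  then show False using eventually_pos[of "N * n"] zero[of N] by simp
qed

lemma joint_dist_int_lower_bound:
  fixes \<tau> \<tau>' :: real
  assumes lim: "liminf (\<lambda>n. ereal (real n powr \<tau> * joint_dist_int a b n)) > 0" and "\<tau> \<le> \<tau>'"
  obtains \<kappa> where "\<kappa> > 0" "\<And>n. n \<ge> 1 \<Longrightarrow> \<kappa> \<le> real n powr \<tau>' * joint_dist_int a b n"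
proof -
  obtain \<kappa> where \<kappa>_bounds: "\<kappa> > 0" "\<And>n. n \<ge> 1 \<Longrightarrow> \<kappa> \<le> real n powr \<tau> * joint_dist_int a b n"
    using liminf_pos_imp_lower_bound[OF lim] joint_dist_int_pos_of_liminf[OF lim] by auto
  have "real n powr \<tau> * joint_dist_int a b n \<le> real n powr \<tau>' * joint_dist_int a b n"
    if "n \<ge> 1" for n
    using that assms(2) by (intro mult_right_mono powr_mono joint_dist_int_nonneg) auto
  then show ?thesis using \<kappa>_bounds order.trans that by metis
qed

text \<open>The lines \<open>A x + B y + C = 0\<close> are compared with the line \<open>y = a x + b\<close>, which is
  parametrised by \<open>x\<close>.\<close>

definition slope :: "real \<Rightarrow> int \<Rightarrow> int \<Rightarrow> real" where
  "slope a A B = \<bar>of_int A + a * of_int B\<bar>"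

definition line_form :: "real \<Rightarrow> real \<Rightarrow> int \<Rightarrow> int \<Rightarrow> int \<Rightarrow> real \<Rightarrow> real" where
  "line_form a b A B C x = of_int A * x + of_int B * (a * x + b) + of_int C"

definition coeffs_le :: "real \<Rightarrow> real \<Rightarrow> int \<Rightarrow> int \<Rightarrow> int \<Rightarrow> bool" where
  "coeffs_le i j q A B \<longleftrightarrow> (A, B) \<noteq> (0, 0) \<and>
     \<bar>real_of_int A\<bar> \<le> real_of_int q powr i \<and> \<bar>real_of_int B\<bar> \<le> real_of_int q powr j"

text \<open>A line of height at most \<^term>\<open>q\<close> which comes within \<^term>\<open>c / q\<close> of the piece over
  \<^term>\<open>{-X..X}\<close> is not nearly parallel to \<open>y = a x + b\<close>.\<close>

definition transversal_on ::
  "real \<Rightarrow> real \<Rightarrow> real \<Rightarrow> real \<Rightarrow> real \<Rightarrow> real \<Rightarrow> real \<Rightarrow> real \<Rightarrow> bool" where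
  "transversal_on i j a b \<epsilon> X \<kappa> c \<longleftrightarrow> (\<forall>(q::int) A B C x.
     1 \<le> q \<longrightarrow> coeffs_le i j q A B \<longrightarrow> \<bar>x\<bar> \<le> X \<longrightarrow> \<bar>line_form a b A B C x\<bar> \<le> c / q \<longrightarrow>
     \<kappa> * q powr (\<epsilon> - 1) \<le> slope a A B)"

definition transversal :: "real \<Rightarrow> real \<Rightarrow> real \<Rightarrow> real \<Rightarrow> real \<Rightarrow> bool" where
  "transversal i j a b \<epsilon> \<longleftrightarrow> (\<forall>X>0. \<exists>\<kappa>>0. \<exists>c>0. transversal_on i j a b \<epsilon> X \<kappa> c)"

lemma transversal_onD:
  assumes "transversal_on i j a b \<epsilon> X \<kappa> c" "1 \<le> q" "coeffs_le i j q A B" "\<bar>x\<bar> \<le> X"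
    "\<bar>line_form a b A B C x\<bar> \<le> c / q"
  shows "\<kappa> * q powr (\<epsilon> - 1) \<le> slope a A B"
  using assms unfolding transversal_on_def by blast

lemma slope_nonneg: "0 \<le> slope a A B"
  by (simp add: slope_def)

lemma line_form_diff: "\<bar>line_form a b A B C x - line_form a b A B C y\<bar> = slope a A B * \<bar>x - y\<bar>"
  unfolding line_form_def slope_def abs_mult[symmetric] by (simp add: algebra_simps)

lemma joint_dist_int_le_line_form:
  "joint_dist_int a b (nat \<bar>B\<bar>) \<le> \<bar>line_form a b A B C x\<bar> + (1 + \<bar>x\<bar>) * slope a A B"
proof -
  have "dist_int (real_of_int \<bar>B\<bar> * a) \<le> slope a A B"
    using dist_int_abs_mult_le[of B a A] by (simp add: slope_def algebra_simps)
  moreover have "0 \<le> \<bar>x\<bar> * slope a A B" by (simp add: slope_nonneg)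
  moreover have "dist_int (real_of_int \<bar>B\<bar> * b) \<le> \<bar>line_form a b A B C x\<bar> + \<bar>x\<bar> * slope a A B"
  proof -
    have "of_int B * b + of_int C = line_form a b A B C 0" by (simp add: line_form_def)
    then show ?thesis
      using dist_int_abs_mult_le[of B b C] line_form_diff[of a b A B C x 0]
      by (simp add: mult.commute)
  qed
  moreover have abs_B: "real (nat \<bar>B\<bar>) = real_of_int \<bar>B\<bar>" by simp
  ultimately show ?thesis
    using slope_nonneg[of a A B] unfolding joint_dist_int_def distrib_right abs_B
    by (intro max.boundedI) linarith+
qed

lemma nonzero_of_slope_less_1:
  assumes "coeffs_le i j q A B" "slope a A B < 1"
  shows "B \<noteq> 0"
proof
  assume "B = 0"
  then have "\<bar>real_of_int A\<bar> < 1" using assms(2) by (simp add: slope_def)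
  then have "A = 0" by linarith
  then show False using assms(1) \<open>B = 0\<close> by (simp add: coeffs_le_def)
qed

lemma coeff_le_of_slope_less_1:
  assumes "0 < i" "a \<noteq> 0" "1 \<le> q" "coeffs_le i j q A B" "slope a A B < 1"
  shows "\<bar>real_of_int B\<bar> \<le> max 1 (2/\<bar>a\<bar>) * q powr min i j"
proof (cases "j \<le> i")
  case True
  then have "\<bar>real_of_int B\<bar> \<le> 1 * q powr min i j"
    using assms(4) by (simp add: coeffs_le_def min_def)
  also have "\<dots> \<le> max 1 (2/\<bar>a\<bar>) * q powr min i j" by (intro mult_right_mono) auto
  finally show ?thesis .
next
  case False
  have "\<bar>a\<bar> * \<bar>real_of_int B\<bar> \<le> slope a A B + \<bar>real_of_int A\<bar>"
    unfolding slope_def abs_mult[symmetric] by linarith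
  also have "\<dots> \<le> 1 + q powr i" using assms(4,5) by (simp add: coeffs_le_def)
  also have "\<dots> \<le> 2 * q powr i" using assms(1,3) ge_one_powr_ge_zero[of q i] by simp
  finally have "\<bar>real_of_int B\<bar> \<le> 2/\<bar>a\<bar> * q powr i" using assms(2) by (simp add: field_simps)
  also have "\<dots> \<le> max 1 (2/\<bar>a\<bar>) * q powr min i j"
    using False by (intro mult_mono) (auto simp: min_def)
  finally show ?thesis .
qed

lemma coeff_powr_le_of_slope_less_1:
  assumes "0 < i" "0 < j" "a \<noteq> 0" "1 \<le> q" "coeffs_le i j q A B" "slope a A B < 1"
    and "\<epsilon> * min i j \<le> 1"
  shows "\<bar>real_of_int B\<bar> powr (1 / min i j - \<epsilon>)
    \<le> max 1 (2/\<bar>a\<bar>) powr (1 / min i j - \<epsilon>) * q powr (1 - \<epsilon> * min i j)"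
proof -
  have min_pos: "0 < min i j" "min i j \<noteq> 0" using assms(1,2) by auto
  have "\<bar>real_of_int B\<bar> powr (1 / min i j - \<epsilon>)
      \<le> (max 1 (2/\<bar>a\<bar>) * q powr min i j) powr (1 / min i j - \<epsilon>)"
    using coeff_le_of_slope_less_1[OF assms(1,3-6)] assms(7) min_pos
    by (intro powr_mono2) (auto simp: le_divide_eq)
  also have "\<dots> = max 1 (2/\<bar>a\<bar>) powr (1 / min i j - \<epsilon>) * q powr (1 - \<epsilon> * min i j)"
    using min_pos by (simp add: powr_mult powr_powr right_diff_distrib mult.commute)
  finally show ?thesis .
qed

lemma joint_dist_int_le_of_flat_line:
  fixes x X y z \<kappa> :: real
  assumes "\<bar>x\<bar> \<le> X" "\<bar>line_form a b A B C x\<bar> \<le> \<kappa> * y" "slope a A B \<le> \<kappa> * z" "0 \<le> \<kappa>" "y \<le> z"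
  shows "joint_dist_int a b (nat \<bar>B\<bar>) \<le> (2 + X) * \<kappa> * z"
proof -
  have "joint_dist_int a b (nat \<bar>B\<bar>) \<le> \<bar>line_form a b A B C x\<bar> + (1 + \<bar>x\<bar>) * slope a A B"
    by (rule joint_dist_int_le_line_form)
  also have "\<dots> \<le> \<kappa> * z + (1 + X) * (\<kappa> * z)"
    using assms slope_nonneg[of a A B] order.trans[OF assms(2) mult_left_mono[OF assms(5,4)]]
    by (intro add_mono mult_mono) auto
  also have "\<dots> = (2 + X) * \<kappa> * z" by (simp add: algebra_simps)
  finally show ?thesis .
qed

lemma transversal_on_of_lower_bound:
  fixes i j a b \<epsilon> \<kappa> X :: real
  assumes "0 < i" "0 < j" "a \<noteq> 0" and \<epsilon>_bounds: "0 \<le> \<epsilon>" "\<epsilon> * min i j \<le> 1"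
    and bound: "\<And>n::nat. n \<ge> 1 \<Longrightarrow> \<kappa> \<le> real n powr (1 / min i j - \<epsilon>) * joint_dist_int a b n"
    and M_eq: "M = max 1 (2/\<bar>a\<bar>)" and \<kappa>0_bounds: "0 < \<kappa>0" "\<kappa>0 \<le> 1"
    and small: "M powr (1 / min i j - \<epsilon>) * ((2 + X) * \<kappa>0) < \<kappa>"
  shows "transversal_on i j a b (\<epsilon> * min i j) X \<kappa>0 \<kappa>0"
  unfolding transversal_on_def
proof (intro allI impI, rule ccontr)
  fix q A B C :: int and x :: real
  assume q_ge: "1 \<le> q" and coeffs: "coeffs_le i j q A B" and abs_x_le: "\<bar>x\<bar> \<le> X"
    and form: "\<bar>line_form a b A B C x\<bar> \<le> \<kappa>0 / q"
  define \<sigma> where "\<sigma> = min i j"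
  define z where "z = real_of_int q powr (\<epsilon> * \<sigma> - 1)"
  assume "\<not> \<kappa>0 * q powr (\<epsilon> * min i j - 1) \<le> slope a A B"
  then have flat: "slope a A B < \<kappa>0 * z" by (simp add: z_def \<sigma>_def)
  have \<sigma>_bounds: "\<sigma> > 0" using assms(1,2) by (simp add: \<sigma>_def)
  have q_ge_1: "real_of_int q \<ge> 1" using q_ge by simp
  have z_bounds: "0 < z" "z \<le> 1" "1 / q \<le> z"
    using q_ge_1 \<epsilon>_bounds \<sigma>_bounds powr_mono[of "\<epsilon> * \<sigma> - 1" 0 q] powr_mono[of "-1" "\<epsilon> * \<sigma> - 1" q]
    by (auto simp: z_def \<sigma>_def powr_minus_divide)
  have slope_less: "slope a A B < 1" using flat \<kappa>0_bounds z_bounds mult_mono[of \<kappa>0 1 z 1] by simp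
  define n where "n = nat \<bar>B\<bar>"
  have n_bounds: "n \<ge> 1" "real n = \<bar>real_of_int B\<bar>"
    using nonzero_of_slope_less_1[OF coeffs slope_less] by (auto simp: n_def)
  have joint: "joint_dist_int a b n \<le> (2 + X) * \<kappa>0 * z"
    unfolding n_def using abs_x_le form flat \<kappa>0_bounds z_bounds(3)
    by (intro joint_dist_int_le_of_flat_line[where y = "1 / q" and C = C]) auto
  have power: "real n powr (1/\<sigma> - \<epsilon>) \<le> M powr (1/\<sigma> - \<epsilon>) * q powr (1 - \<epsilon> * \<sigma>)"
    unfolding n_bounds(2) M_eq \<sigma>_def
    by (rule coeff_powr_le_of_slope_less_1[OF assms(1-3) q_ge coeffs slope_less \<epsilon>_bounds(2)])
  have "\<kappa> \<le> real n powr (1/\<sigma> - \<epsilon>) * joint_dist_int a b n"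
    unfolding \<sigma>_def by (rule bound[OF n_bounds(1)])
  also have "\<dots> \<le> (M powr (1/\<sigma> - \<epsilon>) * q powr (1 - \<epsilon> * \<sigma>)) * ((2 + X) * \<kappa>0 * z)"
    using power joint joint_dist_int_nonneg[of a b n] by (intro mult_mono) auto
  also have "\<dots> = M powr (1/\<sigma> - \<epsilon>) * ((2 + X) * \<kappa>0) * (q powr (1 - \<epsilon> * \<sigma>) * z)" by simp
  also have "q powr (1 - \<epsilon> * \<sigma>) * z = 1" using q_ge_1 by (simp add: z_def flip: powr_add)
  finally show False using small by (simp add: \<sigma>_def)
qed

lemma transversal_of_liminf:
  fixes i j a b \<epsilon> :: real
  assumes "0 < i" "0 < j" "i + j = 1" "a \<noteq> 0" "0 \<le> \<epsilon>"
    and lim: "liminf (\<lambda>n. ereal (real n powr (1 / min i j - \<epsilon>) * joint_dist_int a b n)) > 0"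
  shows "transversal i j a b (min \<epsilon> 1 * min i j)"
  unfolding transversal_def
proof (intro allI impI)
  fix X :: real assume X_pos: "X > 0"
  have \<sigma>_bounds: "0 < min i j" "min i j \<le> 1" using assms by auto
  obtain \<kappa> where \<kappa>_bounds: "\<kappa> > 0"
    "\<And>n::nat. n \<ge> 1 \<Longrightarrow> \<kappa> \<le> real n powr (1 / min i j - min \<epsilon> 1) * joint_dist_int a b n"
    using joint_dist_int_lower_bound[OF lim, of "1 / min i j - min \<epsilon> 1"] by auto
  define M where "M = max 1 (2/\<bar>a\<bar>)"
  define P where "P = M powr (1 / min i j - min \<epsilon> 1) * (2 + X)"
  define \<kappa>0 where "\<kappa>0 = min 1 (\<kappa> / (2 * P))"
  have "M \<ge> 1" by (simp add: M_def)
  then have P_pos: "P > 0" using X_pos by (simp add: P_def)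
  have \<kappa>0_bounds: "0 < \<kappa>0" "\<kappa>0 \<le> 1" unfolding \<kappa>0_def using \<kappa>_bounds(1) P_pos by auto
  have "P * \<kappa>0 \<le> P * (\<kappa> / (2 * P))" using P_pos unfolding \<kappa>0_def by (intro mult_left_mono) auto
  also have "\<dots> < \<kappa>" using P_pos \<kappa>_bounds(1) by simp
  finally have "M powr (1 / min i j - min \<epsilon> 1) * ((2 + X) * \<kappa>0) < \<kappa>" by (simp add: P_def mult.assoc)
  then have "transversal_on i j a b (min \<epsilon> 1 * min i j) X \<kappa>0 \<kappa>0"
    using assms \<sigma>_bounds \<kappa>0_bounds \<kappa>_bounds(2) mult_mono[of "min \<epsilon> 1" 1 "min i j" 1]
    by (intro transversal_on_of_lower_bound[OF _ _ _ _ _ _ M_def]) auto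
  then show "\<exists>\<kappa>>0. \<exists>c>0. transversal_on i j a b (min \<epsilon> 1 * min i j) X \<kappa> c" using \<kappa>0_bounds by blast
qed

lemma slope_ge_of_rational:
  fixes m d :: int
  assumes "a = m / d" "d > 0" "slope a A B \<noteq> 0"
  shows "1 / d \<le> slope a A B"
proof -
  have "of_int A + a * of_int B = of_int (A * d + m * B) / d"
    using assms(1,2) by (simp add: field_simps)
  then have slope_eq: "slope a A B = of_int \<bar>A * d + m * B\<bar> / d"
    using assms(2) by (simp add: slope_def)
  then have "A * d + m * B \<noteq> 0" using assms(3) by (auto simp del: of_int_add of_int_mult)
  then have "1 \<le> \<bar>A * d + m * B\<bar>" by linarith
  then show ?thesis unfolding slope_eq using assms(2) by (intro divide_right_mono) linarith+
qed

lemma transversal_rational: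
  assumes "a \<in> \<rat>" "transversal i j a b \<epsilon>"
  shows "transversal i j a b 1"
  unfolding transversal_def
proof (intro allI impI)
  fix X :: real assume "X > 0"
  obtain m d :: int where a_eq: "d > 0" "a = m / d"
    using assms(1) by (metis Rats_cases')
  obtain \<kappa> c where "\<kappa> > 0" "c > 0" and transversal_X: "transversal_on i j a b \<epsilon> X \<kappa> c"
    using assms(2) \<open>X > 0\<close> unfolding transversal_def by blast
  have "transversal_on i j a b 1 X (1/d) c"
    unfolding transversal_on_def
  proof (intro allI impI)
    fix q A B C :: int and x :: real
    assume near_line: "1 \<le> q" "coeffs_le i j q A B" "\<bar>x\<bar> \<le> X" "\<bar>line_form a b A B C x\<bar> \<le> c / q"
    have "0 < \<kappa> * q powr (\<epsilon> - 1)" using \<open>\<kappa> > 0\<close> near_line(1) by simp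
    also have "\<dots> \<le> slope a A B" by (rule transversal_onD[OF transversal_X near_line])
    finally show "1/d * q powr (1 - 1) \<le> slope a A B"
      using slope_ge_of_rational[OF a_eq(2,1), of A B] near_line(1) by simp
  qed
  then show "\<exists>\<kappa>>0. \<exists>c>0. transversal_on i j a b 1 X \<kappa> c"
    using a_eq(1) \<open>c > 0\<close> by (intro exI[of _ "1 / d"] conjI exI[of _ c]) auto
qed

lemma coeffs_le_swap: "coeffs_le j i q B A \<longleftrightarrow> coeffs_le i j q A B"
  by (auto simp: coeffs_le_def)

lemma slope_swap: "a \<noteq> 0 \<Longrightarrow> \<bar>a\<bar> * slope (1/a) A B = slope a B A"
  by (simp add: slope_def distrib_left add.commute flip: abs_mult)

lemma line_form_swap:
  "a \<noteq> 0 \<Longrightarrow> line_form (1/a) (- b/a) A B C y = line_form a b B A C ((y - b) / a)"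
  by (simp add: line_form_def field_simps)

lemma transversal_swap:
  assumes "a \<noteq> 0" "transversal i j a b \<epsilon>"
  shows "transversal j i (1/a) (- b/a) \<epsilon>"
  unfolding transversal_def
proof (intro allI impI)
  fix X :: real assume "X > 0"
  define X' where "X' = (X + \<bar>b\<bar>) / \<bar>a\<bar>"
  have "X' > 0" unfolding X'_def using \<open>X > 0\<close> assms(1) by (auto intro!: divide_pos_pos)
  then obtain \<kappa> c where \<kappa>_c_pos: "\<kappa> > 0" "c > 0"
    and transversal_X: "transversal_on i j a b \<epsilon> X' \<kappa> c"
    using assms(2) unfolding transversal_def by blast
  have "transversal_on j i (1/a) (- b/a) \<epsilon> X (\<kappa> / \<bar>a\<bar>) c"
    unfolding transversal_on_def
  proof (intro allI impI)
    fix q A B C :: int and y :: real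
    assume near_line: "1 \<le> q" "coeffs_le j i q A B" "\<bar>y\<bar> \<le> X"
      "\<bar>line_form (1/a) (- b/a) A B C y\<bar> \<le> c / q"
    have "\<bar>(y - b) / a\<bar> \<le> X'"
      unfolding X'_def abs_divide using near_line(3) by (intro divide_right_mono) auto
    then have "\<kappa> * q powr (\<epsilon> - 1) \<le> \<bar>a\<bar> * slope (1/a) A B"
      using near_line assms(1) unfolding slope_swap[OF assms(1)]
      by (intro transversal_onD[OF transversal_X, where x = "(y - b) / a" and C = C])
        (auto simp: coeffs_le_swap simp flip: line_form_swap)
    then show "\<kappa> / \<bar>a\<bar> * q powr (\<epsilon> - 1) \<le> slope (1/a) A B"
      using assms(1) by (simp add: field_simps)
  qed
  then show "\<exists>\<kappa>>0. \<exists>c>0. transversal_on j i (1/a) (- b/a) \<epsilon> X \<kappa> c"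
    using \<kappa>_c_pos assms(1) by (intro exI[of _ "\<kappa> / \<bar>a\<bar>"] conjI exI[of _ c]) auto
qed

section \<open>Comparing powers\<close>

lemma powr_le_mult_powr:
  fixes x y K s :: real and d :: nat
  assumes "0 < x" "0 < y" "y \<le> K * x" "1 \<le> K" "0 \<le> s" "s \<le> d"
  shows "y powr s \<le> K ^ d * x powr s"
proof -
  have "y powr s \<le> (K * x) powr s" using assms by (intro powr_mono2) auto
  also have "\<dots> = K powr s * x powr s" using assms by (simp add: powr_mult)
  also have "\<dots> \<le> K ^ d * x powr s"
    using assms powr_mono[of s d K] by (intro mult_right_mono) (auto simp: powr_realpow)
  finally show ?thesis .
qed

lemma le_mult_of_powr_le:
  fixes x y K s :: real
  assumes "0 < x" "0 < y" "y powr s \<le> K * x powr s" "1 \<le> K" "1 \<le> s"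
  shows "y \<le> K * x"
proof (rule ccontr)
  assume "\<not> ?thesis"
  then have "(K * x) powr s < y powr s" using assms by (intro powr_less_mono2) auto
  moreover have "K * x powr s \<le> K powr s * x powr s"
    using assms powr_mono[of 1 s K] by (intro mult_right_mono) auto
  ultimately show False using assms by (simp add: powr_mult)
qed

lemma power_level_exists:
  fixes z G :: real
  assumes "1 \<le> z" "G > 1"
  obtains n where "G ^ n \<le> z" "z < G ^ Suc n"
proof -
  obtain N where "z < G ^ N" using real_arch_pow[OF assms(2)] by blast
  then obtain n where "\<forall>k\<le>n. \<not> z < G ^ k" "z < G ^ Suc n"
    using ex_least_nat_less[of "\<lambda>n. z < G ^ n" N] assms(1) by auto
  then show ?thesis using that[of n] by (simp add: not_less)
qed

section \<open>Rational points and lines\<close>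

definition near :: "real \<Rightarrow> real \<Rightarrow> real \<Rightarrow> int \<Rightarrow> real \<Rightarrow> real \<Rightarrow> real \<Rightarrow> real \<Rightarrow> bool" where
  "near i j e q p r x y \<longleftrightarrow>
     \<bar>q * x - p\<bar> \<le> e * real_of_int q powr (- i) \<and> \<bar>q * y - r\<bar> \<le> e * real_of_int q powr (- j)"

lemma Bad_swap: "(y, x) \<in> Bad (\<delta>, \<gamma>) j i \<longleftrightarrow> (x, y) \<in> Bad (\<gamma>, \<delta>) i j"
  by (simp add: Bad_def max.commute)

lemma BadI:
  assumes weights: "0 < i" "0 < j" and c_pos: "c > 0"
    and far: "\<And>q p r. 1 \<le> q \<Longrightarrow> \<not> near i j c q (of_int p + \<gamma>) (of_int r + \<delta>) x y"
  shows "(x, y) \<in> Bad (\<gamma>, \<delta>) i j"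
proof -
  define c2 where "c2 = min (c powr (1/i)) (c powr (1/j))"
  have root_less: "c2 / q < d powr (1/s)"
    if "s = i \<or> s = j" "1 \<le> q" "c * real q powr (- s) < d" for s d and q :: nat
  proof -
    have "c2 / q \<le> c powr (1/s) / q" using that(1) by (auto simp: c2_def intro!: divide_right_mono)
    also have "\<dots> = (c * real q powr (- s)) powr (1/s)"
      using that weights c_pos by (auto simp: powr_divide powr_powr powr_minus_divide)
    also have "\<dots> < d powr (1/s)"
      using that weights c_pos by (intro powr_less_mono2) auto
    finally show ?thesis .
  qed
  have "c2 / q < max (dist_int (real q * x - \<gamma>) powr (1/i)) (dist_int (real q * y - \<delta>) powr (1/j))"
    if q_bounds: "q \<ge> 1" for q :: nat
  proof -
    obtain p where p_attained: "dist_int (real q * x - \<gamma>) = \<bar>real q * x - \<gamma> - of_int p\<bar>"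
      by (rule dist_int_attained)
    obtain r where r_attained: "dist_int (real q * y - \<delta>) = \<bar>real q * y - \<delta> - of_int r\<bar>"
      by (rule dist_int_attained)
    have "c * real q powr (- i) < dist_int (real q * x - \<gamma>) \<or>
          c * real q powr (- j) < dist_int (real q * y - \<delta>)"
      using far[of "int q" p r] q_bounds unfolding p_attained r_attained near_def
      by (simp add: algebra_simps not_le)
    then show ?thesis
      using root_less[of i q] root_less[of j q] q_bounds by (auto simp: less_max_iff_disj)
  qed
  moreover have "c2 > 0" unfolding c2_def using c_pos by simp
  ultimately show ?thesis unfolding Bad_def by auto
qed

lemma incident_line_exists:
  fixes q p r :: int
  assumes "i + j = 1" "1 \<le> q"
  obtains A B C :: int where "coeffs_le i j q A B" "A * p + B * r + C * q = 0"
proof -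
  define M N where "M = \<lfloor>real_of_int q powr i\<rfloor>" and "N = \<lfloor>real_of_int q powr j\<rfloor>"
  have MN_nonneg: "M \<ge> 0" "N \<ge> 0" unfolding M_def N_def by auto
  define f where "f = (\<lambda>(x, y). (x * p + y * r) mod q)"
  have "real_of_int q = q powr i * q powr j" using assms by (simp flip: powr_add)
  also have "\<dots> < (of_int M + 1) * (of_int N + 1)"
    unfolding M_def N_def using assms(2) by (intro mult_strict_mono) (auto simp: add_nonneg_pos)
  finally have "real_of_int q < of_int ((M + 1) * (N + 1))" by simp
  then have "nat q < nat ((M + 1) * (N + 1))" using assms(2) by linarith
  then have "card {0..<q} < card ({0..M} \<times> {0..N})" using MN_nonneg by (simp add: nat_mult_distrib)
  moreover have "f ` ({0..M} \<times> {0..N}) \<subseteq> {0..<q}" unfolding f_def using assms(2) by auto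
  ultimately have "\<not> inj_on f ({0..M} \<times> {0..N})"
    by (metis card_inj_on_le finite_atLeastLessThan_int not_le)
  then obtain x y x' y' where mem: "x \<in> {0..M}" "x' \<in> {0..M}" "y \<in> {0..N}" "y' \<in> {0..N}"
    "(x, y) \<noteq> (x', y')" "(x * p + y * r) mod q = (x' * p + y' * r) mod q"
    unfolding inj_on_def f_def by auto
  then obtain k where k_eq: "(x * p + y * r) - (x' * p + y' * r) = q * k"
    by (metis mod_eq_dvd_iff dvdE)
  show ?thesis
  proof (rule that)
    have "\<bar>x - x'\<bar> \<le> M" "\<bar>y - y'\<bar> \<le> N" using mem by auto
    then have "\<bar>real_of_int (x - x')\<bar> \<le> q powr i" "\<bar>real_of_int (y - y')\<bar> \<le> q powr j"
      unfolding M_def N_def by linarith+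
    then show "coeffs_le i j q (x - x') (y - y')" using mem(5) by (auto simp: coeffs_le_def)
    show "(x - x') * p + (y - y') * r + - k * q = 0" using k_eq by (simp add: algebra_simps)
  qed
qed

lemma minors_vanish_of_incident:
  fixes A B C A' B' C' p q r p' q' r' :: int
  assumes "A * p + B * r + C * q = 0" "A' * p' + B' * r' + C' * q' = 0"
    "A * p' + B * r' + C * q' = 0" "A' * p + B' * r + C' * q = 0"
    and "q \<noteq> 0" "p * q' \<noteq> p' * q"
  shows "A * B' = A' * B" "A * C' = A' * C" "B * C' = B' * C"
proof -
  have "(A * B' - A' * B) * (p * q' - p' * q) = 0" using assms(1-4) by algebra
  then show parallel: "A * B' = A' * B" using assms(6) by simp
  have "q * (A * C' - A' * C) = 0" "q * (B * C' - B' * C) = 0" using assms(1-4) parallel by algebra+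
  then show "A * C' = A' * C" "B * C' = B' * C" using assms(5) by auto
qed

lemma shift_difference_le:
  fixes q q' z z' \<zeta> \<zeta>' e :: real
  assumes "\<bar>q * z - \<zeta>\<bar> \<le> e" "\<bar>q' * z' - \<zeta>'\<bar> \<le> e" "0 \<le> q"
  shows "\<bar>(q' - q) * z' - (\<zeta>' - \<zeta>)\<bar> \<le> 2 * e + q * \<bar>z - z'\<bar>"
proof -
  have "(q' - q) * z' - (\<zeta>' - \<zeta>) = (q' * z' - \<zeta>') - (q * z - \<zeta>) + q * (z - z')"
    by (simp add: algebra_simps)
  moreover have "\<bar>q * (z - z')\<bar> = q * \<bar>z - z'\<bar>" using assms(3) by (simp add: abs_mult)
  ultimately show ?thesis using assms(1,2) by linarith
qed

lemma near_nonneg: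
  assumes "near i j e q p r x y" "1 \<le> q"
  shows "0 \<le> e"
proof -
  have "0 \<le> e * real_of_int q powr (- i)" using assms(1) unfolding near_def by linarith
  then show ?thesis using assms(2) by (simp add: zero_le_mult_iff)
qed

lemma near_of_int_sgn_iff:
  fixes q p r :: int and x y :: real
  assumes "q \<noteq> 0"
  shows "near i j e \<bar>q\<bar> (of_int (sgn q * p)) (of_int (sgn q * r)) x y \<longleftrightarrow>
    \<bar>p - q * x\<bar> \<le> e * real_of_int \<bar>q\<bar> powr (- i) \<and> \<bar>r - q * y\<bar> \<le> e * real_of_int \<bar>q\<bar> powr (- j)"
proof -
  have "\<bar>real_of_int \<bar>q\<bar> * z - of_int (sgn q * w)\<bar> = \<bar>of_int w - of_int q * z\<bar>" for z and w :: int
    using assms by (cases "q > 0") (auto simp: sgn_if abs_minus_commute)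
  then show ?thesis by (simp only: near_def)
qed

lemma incidence_defect_le:
  fixes q q' :: int and N :: real
  assumes coeffs: "coeffs_le i j q A B" and near: "near i j e q' p' r' x (a * x + b)"
    and weights: "0 \<le> i" "i \<le> 1" "0 \<le> j" "j \<le> 1"
    and q_bounds: "1 \<le> q" "1 \<le> q'" "q \<le> N * q'" and N_ge_1: "1 \<le> N"
  shows "\<bar>q' * line_form a b A B C x - (A * p' + B * r' + C * q')\<bar> \<le> 2 * e * N"
proof -
  have e_nonneg: "0 \<le> e" by (rule near_nonneg[OF near q_bounds(2)])
  have product_le: "\<bar>u * v\<bar> \<le> e * N"
    if "\<bar>u\<bar> \<le> real_of_int q powr s" "\<bar>v\<bar> \<le> e * real_of_int q' powr (- s)" "0 \<le> s" "s \<le> 1" for u v s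
  proof -
    have "\<bar>u * v\<bar> \<le> q powr s * (e * q' powr (- s))"
      unfolding abs_mult using that by (intro mult_mono) auto
    also have "\<dots> \<le> N * q' powr s * (e * q' powr (- s))"
      using powr_le_mult_powr[of q' q N s 1] q_bounds N_ge_1 that e_nonneg
      by (intro mult_right_mono) auto
    also have "\<dots> = e * N" using q_bounds by (simp add: powr_minus)
    finally show ?thesis .
  qed
  have "\<bar>A * (q' * x - p')\<bar> \<le> e * N" "\<bar>B * (q' * (a * x + b) - r')\<bar> \<le> e * N"
    using coeffs near weights product_le unfolding coeffs_le_def near_def by blast+
  moreover have "q' * line_form a b A B C x - (A * p' + B * r' + C * q')
      = A * (q' * x - p') + B * (q' * (a * x + b) - r')"
    by (simp add: line_form_def algebra_simps)
  ultimately show ?thesis by linarith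
qed

lemma line_form_le_of_near:
  fixes q p r A B C :: int
  assumes "coeffs_le i j q A B" "A * p + B * r + C * q = 0" "near i j e q p r x (a * x + b)"
    and "0 \<le> i" "i \<le> 1" "0 \<le> j" "j \<le> 1" "1 \<le> q"
  shows "\<bar>line_form a b A B C x\<bar> \<le> 2 * e / q"
proof -
  have "real_of_int A * p + B * r + C * q = of_int (A * p + B * r + C * q)" by simp
  then have "\<bar>q * line_form a b A B C x\<bar> \<le> 2 * e"
    using incidence_defect_le[OF assms(1,3-8,8), of 1 C] assms(2) by simp
  then show ?thesis using assms(8) by (simp add: abs_mult field_simps)
qed

definition line_root :: "real \<Rightarrow> real \<Rightarrow> int \<Rightarrow> int \<Rightarrow> int \<Rightarrow> real" where
  "line_root a b A B C = - ((of_int B * b + of_int C) / (of_int A + a * of_int B))"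

lemma abs_line_form_eq:
  assumes "slope a A B > 0"
  shows "\<bar>line_form a b A B C x\<bar> = slope a A B * \<bar>x - line_root a b A B C\<bar>"
proof -
  have "of_int A + a * of_int B \<noteq> 0" using assms by (auto simp: slope_def)
  then have "line_form a b A B C x = (of_int A + a * of_int B) * (x - line_root a b A B C)"
    by (simp add: line_form_def line_root_def field_simps)
  then show ?thesis by (simp add: abs_mult slope_def)
qed

lemma line_root_eq_of_minors_vanish:
  assumes "slope a A B > 0" "slope a A' B' > 0"
    and "A * B' = A' * B" "A * C' = A' * C" "B * C' = B' * C"
  shows "line_root a b A B C = line_root a b A' B' C'"
proof -
  have "real_of_int A * B' = real_of_int A' * B" "real_of_int A * C' = real_of_int A' * C"
    "real_of_int B * C' = real_of_int B' * C"
    using assms(3-5) by (simp_all flip: of_int_mult)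
  then have "(B * b + C) * (A' + a * B') = (B' * b + C') * (A + a * B)" by algebra
  moreover have "of_int A + a * of_int B \<noteq> 0" "of_int A' + a * of_int B' \<noteq> 0"
    using assms(1,2) by (auto simp: slope_def)
  ultimately show ?thesis by (simp add: line_root_def frac_eq_eq)
qed

lemma cross_difference_le:
  fixes u u' F F' Q Q' N K s :: real
  assumes u_bounds: "\<bar>u\<bar> \<le> Q powr s" "\<bar>u'\<bar> \<le> Q' powr s"
    and F_bounds: "\<bar>F\<bar> \<le> K / Q" "\<bar>F'\<bar> \<le> K / Q'"
    and Q_bounds: "0 < Q" "0 < Q'" "Q' \<le> N * Q" "Q \<le> N * Q'"
    and N_ge_1: "1 \<le> N" and s_bounds: "0 \<le> s" "s \<le> 1"
  shows "\<bar>u * F' - u' * F\<bar> \<le> 2 * N * K * Q powr (s - 1)"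
proof -
  have K_nonneg: "0 \<le> K"
    using F_bounds(1) Q_bounds(1) by (metis abs_ge_zero order.trans zero_le_divide_iff not_le)
  have "\<bar>u * F' - u' * F\<bar> \<le> \<bar>u\<bar> * \<bar>F'\<bar> + \<bar>u'\<bar> * \<bar>F\<bar>" by (simp flip: abs_mult)
  also have "\<dots> \<le> Q powr s * (K * (N / Q)) + (N * Q powr s) * (K / Q)"
  proof (intro add_mono mult_mono)
    have "1 / Q' \<le> N / Q" using Q_bounds by (simp add: field_simps)
    then show "\<bar>F'\<bar> \<le> K * (N / Q)"
      using F_bounds(2) mult_left_mono[of "1 / Q'" "N / Q" K] K_nonneg by simp
    show "\<bar>u'\<bar> \<le> N * Q powr s"
      using powr_le_mult_powr[of Q Q' N s 1] Q_bounds N_ge_1 s_bounds u_bounds(2) by simp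
  qed (use u_bounds F_bounds N_ge_1 Q_bounds in auto)
  also have "\<dots> = 2 * N * K * Q powr (s - 1)" using Q_bounds by (simp add: powr_diff)
  finally show ?thesis .
qed

section \<open>Dangerous sets\<close>

locale dangerous_sets =
  fixes i j a b \<gamma> \<delta> u0 l R X \<kappa>0 c0 \<epsilon> \<kappa> :: real and g t0 :: nat
  assumes weights: "0 < j" "j \<le> i" "i + j = 1"
    and l_pos: "l > 0" and R_ge_4: "R \<ge> 4"
    and start_subset: "{u0..u0 + l} \<subseteq> {-X..X}"
    and \<kappa>0_bounds: "0 < \<kappa>0" "\<kappa>0 \<le> 1"
    and transversal: "transversal_on i j a b \<epsilon> X \<kappa>0 c0"
    and \<epsilon>_bounds: "0 < \<epsilon>" "2 \<le> real g * \<epsilon>" and g_j_bound: "3 \<le> real g * j"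
    and \<kappa>_bounds: "0 < \<kappa>" "\<kappa> \<le> c0" "\<kappa> * (1 + \<bar>a\<bar>) \<le> l * \<kappa>0\<^sup>2"
      "\<kappa> * (8 * R\<^sup>2 * R ^ g * (1 + \<bar>a\<bar>)) \<le> \<kappa>0"
    and t0_large: "32 * (1 + \<bar>a\<bar>)\<^sup>2 * R ^ (11 + 3 * g) \<le> R ^ t0"
begin

definition W :: real where "W = 1 + \<bar>a\<bar>"

definition G :: real where "G = R ^ g"

definition len :: "nat \<Rightarrow> real" where "len n = l * (1/R) ^ n"

text \<open>Homogeneous points of height \<^term>\<open>q\<close> are avoided with the constant \<open>c\<close> as soon as
  \<open>len n * q powr (1 + i) \<le> \<rho>\<close>; the primed constants serve for inhomogeneous points.\<close>

definition \<rho> :: real where "\<rho> = \<kappa> / (W * R ^ (8 + t0))"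

definition c :: real where "c = \<rho> / 4"

definition \<rho>' :: real where "\<rho>' = c / (R ^ 3 * (1 + W))"

definition c' :: real where "c' = \<rho>' / (2 * R ^ 7)"

text \<open>The truncated subtraction \<^term>\<open>t - t0\<close> is intended: the classes \<^prop>\<open>t \<le> t0\<close> are treated
  when the interval has length about \<^term>\<open>\<kappa> / (q * D)\<close>, the others earlier.\<close>

definition graded :: "nat \<Rightarrow> nat \<Rightarrow> int \<Rightarrow> real \<Rightarrow> bool" where
  "graded n t q D \<longleftrightarrow>
     G ^ t * D \<le> W * q powr i \<and> W * q powr i < G ^ Suc t * D \<and>
     len (Suc n) * (q * D) < \<kappa> * R ^ (t - t0) \<and> \<kappa> * R ^ (t - t0) \<le> len n * (q * D)"

definition hit :: "nat \<Rightarrow> nat \<Rightarrow> real \<Rightarrow> int \<Rightarrow> int \<Rightarrow> int \<Rightarrow> int \<Rightarrow> int \<Rightarrow> int \<Rightarrow> bool" where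
  "hit n t x q p r A B C \<longleftrightarrow> 1 \<le> q \<and> coeffs_le i j q A B \<and> A * p + B * r + C * q = 0 \<and>
     near i j c q p r x (a * x + b) \<and> graded n t q (slope a A B)"

definition shifted_hit :: "nat \<Rightarrow> real \<Rightarrow> int \<Rightarrow> int \<Rightarrow> int \<Rightarrow> bool" where
  "shifted_hit n x q p r \<longleftrightarrow> 1 \<le> q \<and> near i j c' q (p + \<gamma>) (r + \<delta>) x (a * x + b) \<and>
     len (Suc n) * q powr (1 + i) < \<rho>' \<and> \<rho>' \<le> len n * q powr (1 + i)"

primrec danger :: "nat \<Rightarrow> nat \<Rightarrow> real set" where
  "danger n 0 = {x. \<exists>q p r. shifted_hit n x q p r}"
| "danger n (Suc t) = {x. \<exists>q p r A B C. hit n t x q p r A B C}"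

definition clear_interval :: "nat \<Rightarrow> real \<Rightarrow> bool" where
  "clear_interval n v \<longleftrightarrow> {v..v + len n} \<subseteq> {u0..u0 + l} \<and> cleared danger n {v..v + len n}"

lemma weights_bounds: "0 < i" "0 \<le> i" "i \<le> 1" "0 \<le> j" "j \<le> 1"
  using weights by auto

lemma W_bounds: "W \<ge> 1" "W > 0"
  by (auto simp: W_def)

lemma R_bounds: "R > 0" "R \<ge> 1" "R > 1"
  using R_ge_4 by auto

lemma g_pos: "g > 0"
  using \<epsilon>_bounds by (cases g) auto

lemma G_bounds: "G > 1" "G \<ge> 1" "G > 0"
  using R_bounds g_pos one_less_power[of R g] by (auto simp: G_def)

lemma RG_ge_1: "R * G \<ge> 1"
  using mult_mono[of 1 R 1 G] R_bounds G_bounds by simp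

lemma len_pos: "len n > 0"
  using l_pos R_bounds by (simp add: len_def)

lemma len_Suc: "len n = R * len (Suc n)"
  using R_bounds by (simp add: len_def)

lemma len_deadline: "len (deadline n m) * R ^ (7 + m) = len n"
  using R_bounds by (simp add: len_def deadline_def power_add power_divide)

lemma len_strict_antimono: "m < n \<Longrightarrow> len n < len m"
  using R_bounds l_pos by (simp add: len_def power_strict_decreasing)

lemma constants_pos: "\<rho> > 0" "c > 0" "\<rho>' > 0" "c' > 0"
  using \<kappa>_bounds W_bounds R_bounds by (simp_all add: \<rho>_def c_def \<rho>'_def c'_def)

lemma c_le_\<kappa>: "4 * c \<le> \<kappa>"
proof -
  have "1 \<le> W * R ^ (8 + t0)"
    using W_bounds R_bounds mult_mono[of 1 W 1 "R ^ (8 + t0)"] one_le_power by fastforce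
  then show ?thesis using \<kappa>_bounds by (simp add: c_def \<rho>_def divide_le_eq)
qed

lemma \<kappa>_mult_le_\<kappa>0: "\<kappa> * (8 * R\<^sup>2 * G * W) \<le> \<kappa>0"
  using \<kappa>_bounds(4) by (simp add: W_def G_def)

lemma level_exists:
  assumes "0 < y" "y \<le> l * z"
  obtains n where "len (Suc n) * z < y" "y \<le> len n * z"
proof -
  obtain n where "R ^ n \<le> l * z / y" "l * z / y < R ^ Suc n"
    using power_level_exists[of "l * z / y" R] assms R_bounds by auto
  then have "len (Suc n) * z < y" "y \<le> len n * z"
    using assms R_bounds by (auto simp: len_def power_divide field_simps)
  then show ?thesis by (rule that)
qed

lemma slope_le:
  assumes "1 \<le> q" "coeffs_le i j q A B"
  shows "slope a A B \<le> W * q powr i"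
proof -
  have "real_of_int q powr j \<le> q powr i" using assms weights by (intro powr_mono) auto
  then have "\<bar>real_of_int B\<bar> \<le> q powr i" using assms by (simp add: coeffs_le_def)
  then have "\<bar>a\<bar> * \<bar>real_of_int B\<bar> \<le> \<bar>a\<bar> * q powr i" by (intro mult_left_mono) auto
  moreover have "slope a A B \<le> \<bar>real_of_int A\<bar> + \<bar>a\<bar> * \<bar>real_of_int B\<bar>"
    unfolding slope_def by (simp flip: abs_mult)
  ultimately show ?thesis using assms by (simp add: W_def coeffs_le_def algebra_simps)
qed

lemma slope_ge:
  fixes q p r A B C :: int
  assumes "1 \<le> q" "coeffs_le i j q A B" "A * p + B * r + C * q = 0"
    "near i j c q p r x (a * x + b)" "\<bar>x\<bar> \<le> X"
  shows "\<kappa>0 * q powr (\<epsilon> - 1) \<le> slope a A B"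
proof (rule transversal_onD[OF transversal assms(1,2,5)])
  have "\<bar>line_form a b A B C x\<bar> \<le> 2 * c / q"
    using line_form_le_of_near[OF assms(2-4) weights_bounds(2-5) assms(1)] .
  also have "\<dots> \<le> c0 / q"
    using c_le_\<kappa> constants_pos \<kappa>_bounds assms(1) by (intro divide_right_mono) auto
  finally show "\<bar>line_form a b A B C x\<bar> \<le> c0 / q" .
qed

lemma graded_pos:
  assumes "1 \<le> q" "graded n t q D"
  shows "D > 0"
proof -
  have "0 < W * q powr i" using assms(1) W_bounds by simp
  also have "\<dots> < G ^ Suc t * D" using assms(2) by (simp add: graded_def)
  finally show ?thesis using G_bounds by (auto intro: zero_less_mult_pos)
qed

lemma power_class_le:
  fixes q :: int
  assumes "1 \<le> q" "\<kappa>0 * q powr (\<epsilon> - 1) \<le> D" "G ^ t * D \<le> W * q powr i"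
    and s_bounds: "2 \<le> real g * s"
  shows "R ^ t \<le> W / \<kappa>0 * q powr s"
proof -
  have q_bounds: "real_of_int q \<ge> 1" using assms(1) by simp
  have ratio_ge_1: "1 \<le> W / \<kappa>0" using W_bounds \<kappa>0_bounds by (simp add: le_divide_eq)
  have pos: "0 < \<kappa>0 * q powr (\<epsilon> - 1)" using \<kappa>0_bounds q_bounds by simp
  have "(R ^ t) ^ g * (\<kappa>0 * q powr (\<epsilon> - 1)) \<le> G ^ t * D"
    using assms(2) R_bounds by (simp add: G_def mult_left_mono mult.commute flip: power_mult)
  also have "\<dots> \<le> W * q powr i" by (rule assms(3))
  finally have "(R ^ t) ^ g \<le> W * q powr i / (\<kappa>0 * q powr (\<epsilon> - 1))"
    using pos by (simp add: le_divide_eq)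
  also have "\<dots> = W / \<kappa>0 * q powr (i - (\<epsilon> - 1))" using q_bounds by (simp add: powr_diff)
  also have "\<dots> \<le> W / \<kappa>0 * q powr (real g * s)"
    using q_bounds ratio_ge_1 s_bounds \<epsilon>_bounds weights_bounds
    by (intro mult_left_mono powr_mono) auto
  also have "\<dots> \<le> (W / \<kappa>0) ^ g * q powr (real g * s)"
    using ratio_ge_1 g_pos power_increasing[of 1 g "W / \<kappa>0"] by (intro mult_right_mono) auto
  also have "\<dots> = (W / \<kappa>0 * q powr s) ^ g"
    unfolding power_mult_distrib using q_bounds by (simp add: powr_power)
  finally show ?thesis using g_pos W_bounds \<kappa>0_bounds R_bounds by (simp add: power_mono_iff)
qed

lemma graded_exists:
  assumes "1 \<le> q" "\<kappa>0 * q powr (\<epsilon> - 1) \<le> D" "D \<le> W * q powr i"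
  obtains n t where "graded n t q D"
proof -
  have q_bounds: "real_of_int q > 0" using assms(1) by simp
  have "0 < \<kappa>0 * q powr (\<epsilon> - 1)" using \<kappa>0_bounds q_bounds by simp
  then have D_pos: "D > 0" using assms(2) by linarith
  obtain t where t_class: "G ^ t \<le> W * q powr i / D" "W * q powr i / D < G ^ Suc t"
    using power_level_exists[of "W * q powr i / D" G] D_pos G_bounds assms(3) by auto
  have class_bounds: "G ^ t * D \<le> W * q powr i" "W * q powr i < G ^ Suc t * D"
    using t_class D_pos by (simp_all add: le_divide_eq divide_less_eq)
  have "\<kappa> * R ^ (t - t0) \<le> \<kappa> * R ^ t"
    using \<kappa>_bounds R_bounds by (intro mult_left_mono power_increasing) auto
  also have "\<dots> \<le> \<kappa> * (W / \<kappa>0 * q powr \<epsilon>)"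
    using power_class_le[OF assms(1,2) class_bounds(1) \<epsilon>_bounds(2)] \<kappa>_bounds
    by (intro mult_left_mono) auto
  also have "\<dots> = \<kappa> * W * (q powr \<epsilon> / \<kappa>0)" by simp
  also have "\<dots> \<le> l * \<kappa>0\<^sup>2 * (q powr \<epsilon> / \<kappa>0)"
    using \<kappa>_bounds(3) \<kappa>0_bounds unfolding W_def by (intro mult_right_mono) auto
  also have "\<dots> = l * (q * (\<kappa>0 * q powr (\<epsilon> - 1)))"
    using \<kappa>0_bounds q_bounds by (simp add: power2_eq_square powr_diff)
  also have "\<dots> \<le> l * (q * D)" using assms(2) q_bounds l_pos by (intro mult_left_mono) auto
  finally obtain n where
    "len (Suc n) * (q * D) < \<kappa> * R ^ (t - t0)" "\<kappa> * R ^ (t - t0) \<le> len n * (q * D)"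
    using level_exists[of "\<kappa> * R ^ (t - t0)" "q * D"] \<kappa>_bounds R_bounds by auto
  then show ?thesis using that[of n t] class_bounds by (simp add: graded_def)
qed

lemma graded_deadline_ge:
  assumes "graded n t q D"
  shows "\<rho> * W \<le> len (deadline n (Suc t)) * (q * D)"
proof -
  have "\<rho> * W * R ^ (7 + Suc t) \<le> \<rho> * W * (R ^ (8 + t0) * R ^ (t - t0))"
    unfolding power_add[symmetric] using constants_pos W_bounds R_bounds
    by (intro mult_left_mono power_increasing) auto
  also have "\<dots> = \<kappa> * R ^ (t - t0)" using W_bounds R_bounds by (simp add: \<rho>_def)
  also have "\<dots> \<le> len n * (q * D)" using assms by (simp add: graded_def)
  also have "\<dots> = len (deadline n (Suc t)) * (q * D) * R ^ (7 + Suc t)"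
    by (simp only: len_deadline[of n "Suc t", symmetric] mult_ac)
  finally show ?thesis using R_bounds by (simp add: mult_le_cancel_right)
qed

lemma height_gt_of_near:
  assumes clear: "clear_interval n v" and mem: "x \<in> {v..v + len n}"
    and q_bounds: "1 \<le> q" and near: "near i j c q (of_int p) (of_int r) x (a * x + b)"
  shows "\<rho> < len n * q powr (1 + i)"
proof -
  obtain A B C where coeffs: "coeffs_le i j q A B" "A * p + B * r + C * q = 0"
    using incident_line_exists[OF weights(3) q_bounds, of p r] by metis
  have "x \<in> {-X..X}" using clear mem start_subset unfolding clear_interval_def by blast
  then have "\<bar>x\<bar> \<le> X" by auto
  then have "\<kappa>0 * q powr (\<epsilon> - 1) \<le> slope a A B" by (rule slope_ge[OF q_bounds coeffs near])
  then obtain k t where graded: "graded k t q (slope a A B)"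
    using graded_exists[OF q_bounds _ slope_le[OF q_bounds coeffs(1)]] by blast
  then have "hit k t x q p r A B C" using q_bounds coeffs near by (simp add: hit_def)
  then have "x \<in> danger k (Suc t)" unfolding danger.simps by blast
  then have "n < deadline k (Suc t)"
    using clear mem unfolding clear_interval_def cleared_def by (metis disjoint_iff not_le)
  then have less: "len (deadline k (Suc t)) < len n" by (rule len_strict_antimono)
  have "\<rho> * W \<le> len (deadline k (Suc t)) * (q * slope a A B)"
    by (rule graded_deadline_ge[OF graded])
  also have "\<dots> \<le> len (deadline k (Suc t)) * (q * (W * q powr i))"
    using slope_le[OF q_bounds coeffs(1)] q_bounds len_pos[of "deadline k (Suc t)"]
    by (intro mult_left_mono) auto
  also have "\<dots> = len (deadline k (Suc t)) * q powr (1 + i) * W"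
    using q_bounds by (simp add: powr_add)
  finally have "\<rho> \<le> len (deadline k (Suc t)) * q powr (1 + i)" using W_bounds by simp
  also have "\<dots> < len n * q powr (1 + i)" using less q_bounds by simp
  finally show ?thesis .
qed

lemma hitD:
  assumes "hit n t x q p r A B C"
  shows "1 \<le> q" "coeffs_le i j q A B" "A * p + B * r + C * q = 0"
    "near i j c q p r x (a * x + b)" "graded n t q (slope a A B)" "slope a A B > 0"
  using assms graded_pos by (auto simp: hit_def)

lemma graded_height_ratio:
  fixes q q' :: int
  assumes q_bounds: "1 \<le> q" "1 \<le> q'" and graded: "graded n t q D" "graded n t q' D'"
  shows "q' \<le> R * G * q"
proof (rule le_mult_of_powr_le)
  have D_pos: "D > 0" "D' > 0" using graded_pos q_bounds graded by blast+
  have "len (Suc n) * (q' * D') \<le> len n * (q * D)" using graded by (simp add: graded_def)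
  then have "len (Suc n) * (q' * D') \<le> len (Suc n) * (R * (q * D))"
    by (simp add: len_Suc[of n] mult_ac)
  then have "q' * D' \<le> R * (q * D)" using len_pos[of "Suc n"] by simp
  moreover have "(W * q' powr i) * (G ^ t * D) \<le> (G ^ Suc t * D') * (W * q powr i)"
    by (rule mult_mono) (use graded D_pos W_bounds G_bounds in \<open>auto simp: graded_def\<close>)
  ultimately have "(q' * D') * ((W * q' powr i) * (G ^ t * D))
      \<le> (R * (q * D)) * ((G ^ Suc t * D') * (W * q powr i))"
    by (rule mult_mono) (use q_bounds D_pos W_bounds G_bounds R_bounds in auto)
  then have "(D * D' * W * G ^ t) * (q' * q' powr i)
      \<le> (D * D' * W * G ^ t) * (R * G * (q * q powr i))"
    by (simp add: mult_ac)
  then show "q' powr (1 + i) \<le> R * G * q powr (1 + i)"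
    using D_pos W_bounds G_bounds q_bounds by (simp add: powr_add)
qed (use q_bounds RG_ge_1 weights_bounds in auto)

lemma line_form_le_of_hit:
  assumes "hit n t x q p r A B C" "\<bar>x - y\<bar> \<le> len n"
  shows "\<bar>line_form a b A B C y\<bar> \<le> 2 * \<kappa> * R ^ (t - t0) * R / q"
proof -
  note hit = hitD[OF assms(1)]
  have q_bounds: "real_of_int q > 0" using hit by simp
  have "1 * 1 \<le> R ^ (t - t0) * R" using R_bounds by (intro mult_mono) auto
  then have "\<kappa> * 1 \<le> \<kappa> * (R ^ (t - t0) * R)" using \<kappa>_bounds by (intro mult_left_mono) auto
  then have "2 * c \<le> \<kappa> * R ^ (t - t0) * R"
    using c_le_\<kappa> constants_pos unfolding mult.assoc by linarith
  moreover have "len n * (q * slope a A B) \<le> \<kappa> * R ^ (t - t0) * R"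
    using hit(5) R_bounds by (simp add: len_Suc[of n] graded_def mult_ac)
  moreover have "q * \<bar>line_form a b A B C y\<bar> \<le> 2 * c + len n * (q * slope a A B)"
  proof -
    have "\<bar>line_form a b A B C y\<bar> \<le> \<bar>line_form a b A B C x\<bar> + slope a A B * \<bar>x - y\<bar>"
      using line_form_diff[of a b A B C x y] by linarith
    also have "\<dots> \<le> 2 * c / q + slope a A B * len n"
      using line_form_le_of_near[OF hit(2-4) weights_bounds(2-5) hit(1)]
        assms(2) slope_nonneg[of a A B]
      by (intro add_mono mult_left_mono) auto
    finally have "q * \<bar>line_form a b A B C y\<bar> \<le> q * (2 * c / q + slope a A B * len n)"
      using q_bounds by (intro mult_left_mono) auto
    then show ?thesis using q_bounds by (simp add: distrib_left mult_ac)
  qed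
  ultimately show ?thesis using q_bounds by (simp add: le_divide_eq mult_ac)
qed

lemma near_line_root_of_hit:
  assumes "hit n t x q p r A B C"
  shows "\<bar>x - line_root a b A B C\<bar> \<le> len (deadline n (Suc t)) / 2"
proof -
  note hit = hitD[OF assms]
  have qD_pos: "0 < q * slope a A B" using hit by simp
  have "slope a A B * \<bar>x - line_root a b A B C\<bar> \<le> 2 * c / q"
    using line_form_le_of_near[OF hit(2-4) weights_bounds(2-5) hit(1)] abs_line_form_eq[OF hit(6)]
    by simp
  then have "\<bar>x - line_root a b A B C\<bar> * (q * slope a A B) \<le> 2 * c"
    using hit(1) by (simp add: le_divide_eq mult_ac)
  also have "\<dots> \<le> \<rho> * W / 2" using constants_pos W_bounds by (simp add: c_def)
  also have "\<dots> \<le> len (deadline n (Suc t)) / 2 * (q * slope a A B)"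
    using graded_deadline_ge[OF hit(5)] by simp
  finally show ?thesis using qD_pos by (rule mult_right_le_imp_le)
qed

lemma near_abscissa_of_hit:
  assumes "hit n t x q p r A B C"
  shows "\<bar>x - p / q\<bar> \<le> len (deadline n (Suc t)) / 2"
proof -
  note hit = hitD[OF assms]
  have q_bounds: "real_of_int q > 0" using hit by simp
  have "\<bar>x - p / q\<bar> * q = \<bar>q * x - p\<bar>"
    using q_bounds by (simp add: abs_mult_pos field_simps flip: abs_mult)
  also have "\<dots> \<le> c * q powr (- i)" using hit(4) by (simp add: near_def)
  finally have "\<bar>x - p / q\<bar> * q * slope a A B \<le> c * q powr (- i) * (W * q powr i)"
    by (rule mult_mono) (use slope_le[OF hit(1,2)] slope_nonneg[of a A B] constants_pos in auto)
  also have "\<dots> = c * W" using q_bounds by (simp add: powr_minus)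
  also have "\<dots> \<le> \<rho> * W / 2" using constants_pos W_bounds by (simp add: c_def)
  also have "\<dots> \<le> len (deadline n (Suc t)) / 2 * (q * slope a A B)"
    using graded_deadline_ge[OF hit(5)] by simp
  finally have "\<bar>x - p / q\<bar> * (q * slope a A B) \<le> len (deadline n (Suc t)) / 2 * (q * slope a A B)"
    by (simp add: mult.assoc)
  then show ?thesis by (rule mult_right_le_imp_le) (use q_bounds hit in simp)
qed

lemma close_of_same_line:
  assumes "hit n t x q p r A B C" "hit n t x' q' p' r' A' B' C'"
    and "A * B' = A' * B" "A * C' = A' * C" "B * C' = B' * C"
  shows "\<bar>x - x'\<bar> \<le> len (deadline n (Suc t))"
  using near_line_root_of_hit[OF assms(1)] near_line_root_of_hit[OF assms(2)]
    line_root_eq_of_minors_vanish[OF hitD(6)[OF assms(1)] hitD(6)[OF assms(2)] assms(3-5), of b]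
  by linarith

lemma close_of_same_abscissa:
  assumes "hit n t x q p r A B C" "hit n t x' q' p' r' A' B' C'" and "p * q' = p' * q"
  shows "\<bar>x - x'\<bar> \<le> len (deadline n (Suc t))"
proof -
  have "real_of_int p * real_of_int q' = real_of_int p' * real_of_int q"
    using assms(3) by (simp flip: of_int_mult)
  then have "real_of_int p / q = p' / q'"
    using hitD(1)[OF assms(1)] hitD(1)[OF assms(2)] by (simp add: frac_eq_eq)
  then show ?thesis
    using near_abscissa_of_hit[OF assms(1)] near_abscissa_of_hit[OF assms(2)] by linarith
qed

subsection \<open>Classes of bounded order\<close>

lemma incident_of_low_class:
  assumes hits: "hit n t x q p r A B C" "hit n t x' q' p' r' A' B' C'"
    and "\<bar>x - x'\<bar> \<le> len n" "t \<le> t0"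
  shows "A * p' + B * r' + C * q' = 0"
proof -
  note hit = hitD[OF hits(1)] and hit' = hitD[OF hits(2)]
  have q_bounds: "real_of_int q > 0" "real_of_int q' > 0" using hit hit' by auto
  have "\<bar>line_form a b A B C x'\<bar> \<le> 2 * \<kappa> * R / q"
    using line_form_le_of_hit[OF hits(1) assms(3)] \<open>t \<le> t0\<close> by simp
  then have "q' * \<bar>line_form a b A B C x'\<bar> \<le> (R * G * q) * (2 * \<kappa> * R / q)"
    using graded_height_ratio[OF hit(1) hit'(1) hit(5) hit'(5)] q_bounds \<kappa>_bounds RG_ge_1
    by (intro mult_mono) auto
  also have "\<dots> = 2 * (\<kappa> * (R\<^sup>2 * G))" using q_bounds by (simp add: power2_eq_square)
  finally have form: "\<bar>q' * line_form a b A B C x'\<bar> \<le> 2 * (\<kappa> * (R\<^sup>2 * G))"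
    using q_bounds by (simp add: abs_mult)
  have defect: "\<bar>q' * line_form a b A B C x' - of_int (A * p' + B * r' + C * q')\<bar> \<le> 2 * c * (R * G)"
    using incidence_defect_le[OF hit(2) hit'(4) weights_bounds(2-5) hit(1) hit'(1)
        graded_height_ratio[OF hit'(1) hit(1) hit'(5) hit(5)] RG_ge_1, of C] by simp
  have "R * G \<le> R\<^sup>2 * G" using R_bounds G_bounds by (simp add: power2_eq_square)
  then have "2 * c * (R * G) \<le> \<kappa> * (R\<^sup>2 * G)"
    using c_le_\<kappa> constants_pos \<kappa>_bounds R_bounds G_bounds by (intro mult_mono) auto
  moreover have "8 * (\<kappa> * (R\<^sup>2 * G)) \<le> \<kappa> * (8 * R\<^sup>2 * G * W)"
    using \<kappa>_bounds R_bounds G_bounds W_bounds by simp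
  ultimately have "\<bar>real_of_int (A * p' + B * r' + C * q')\<bar> < 1"
    using form defect \<kappa>_mult_le_\<kappa>0 \<kappa>0_bounds by linarith
  then show ?thesis by linarith
qed

lemma close_of_low_class:
  assumes hits: "hit n t x q p r A B C" "hit n t x' q' p' r' A' B' C'"
    and "\<bar>x - x'\<bar> \<le> len n" "t \<le> t0"
  shows "\<bar>x - x'\<bar> \<le> len (deadline n (Suc t))"
proof (cases "p * q' = p' * q")
  case True
  then show ?thesis by (rule close_of_same_abscissa[OF hits])
next
  case False
  have "A * p' + B * r' + C * q' = 0" "A' * p + B' * r + C' * q = 0"
    using incident_of_low_class[OF hits assms(3,4)] incident_of_low_class[OF hits(2,1)] assms(3,4)
    by (simp_all add: abs_minus_commute)
  then show ?thesis
    using minors_vanish_of_incident[OF hitD(3)[OF hits(1)] hitD(3)[OF hits(2)] _ _ _ False]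
      hitD(1)[OF hits(1)] by (intro close_of_same_line[OF hits]) simp_all
qed

subsection \<open>Classes of large order\<close>

definition crossing_error :: "nat \<Rightarrow> real" where
  "crossing_error t = 4 * \<kappa> * R ^ (t + 2) * G"

definition crossing_scale :: real where
  "crossing_scale = 2 * W * R * G"

lemma crossing_scale_ge_1: "crossing_scale \<ge> 1"
  using mult_mono[of 1 "2 * W" 1 "R * G"] W_bounds RG_ge_1
  by (simp add: crossing_scale_def mult.assoc)

lemma crossing_error_pos: "crossing_error t > 0"
  using \<kappa>_bounds R_bounds G_bounds by (simp add: crossing_error_def)

lemma crossing_near:
  assumes hits: "hit n t x q p r A B C" "hit n t x' q' p' r' A' B' C'"
    and dist_le: "\<bar>x' - x\<bar> \<le> len n"
  shows "\<bar>(B * C' - B' * C) - (A * B' - A' * B) * x\<bar> \<le> crossing_error t * q powr (- i)" (is ?P)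
    and "\<bar>(A' * C - A * C') - (A * B' - A' * B) * (a * x + b)\<bar>
      \<le> crossing_error t * q powr (- j)" (is ?R)
proof -
  note hit = hitD[OF hits(1)] and hit' = hitD[OF hits(2)]
  define F F' where "F = line_form a b A B C x" and "F' = line_form a b A' B' C' x"
  define K where "K = 2 * \<kappa> * R ^ t * R"
  have q_bounds: "real_of_int q > 0" "real_of_int q' > 0" using hit hit' by auto
  have K_bounds: "2 * \<kappa> * R ^ (t - t0) * R \<le> K" unfolding K_def using \<kappa>_bounds R_bounds
    by (intro mult_right_mono mult_left_mono power_increasing) auto
  have F_bounds: "\<bar>F\<bar> \<le> K / q" "\<bar>F'\<bar> \<le> K / q'"
    using line_form_le_of_hit[OF hits(1), of x] len_pos[of n]
      line_form_le_of_hit[OF hits(2) dist_le] q_bounds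
      divide_right_mono[OF K_bounds, of q] divide_right_mono[OF K_bounds, of q']
    unfolding F_def F'_def by linarith+
  have ratio: "q' \<le> R * G * q" "q \<le> R * G * q'"
    using graded_height_ratio hit hit' by blast+
  have error_eq: "2 * (R * G) * K = crossing_error t"
    by (simp add: K_def crossing_error_def power_add power2_eq_square)
  have cross: "\<bar>u * F' - u' * F\<bar> \<le> crossing_error t * q powr (s - 1)"
    if "\<bar>u\<bar> \<le> real_of_int q powr s" "\<bar>u'\<bar> \<le> real_of_int q' powr s" "0 \<le> s" "s \<le> 1" for u u' s
    using cross_difference_le[OF that(1,2) F_bounds q_bounds ratio RG_ge_1 that(3,4)]
    unfolding error_eq .
  have exponents: "j - 1 = - i" "i - 1 = - j" using weights by auto
  have "(B * C' - B' * C) - (A * B' - A' * B) * x = B * F' - B' * F"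
    by (simp add: F_def F'_def line_form_def algebra_simps)
  then show ?P
    using cross[of B j B'] hit(2) hit'(2) weights_bounds unfolding coeffs_le_def exponents by simp
  have "(A' * C - A * C') - (A * B' - A' * B) * (a * x + b) = - (A * F' - A' * F)"
    by (simp add: F_def F'_def line_form_def algebra_simps)
  then show ?R
    using cross[of A i A'] hit(2) hit'(2) weights_bounds unfolding coeffs_le_def exponents by simp
qed

lemma crossing_error_less_1:
  assumes "hit n t x q p r A B C" "\<bar>x\<bar> \<le> X"
  shows "crossing_error t * q powr (- j) < 1"
proof -
  note hit = hitD[OF assms(1)]
  have q_bounds: "real_of_int q > 0" using hit by simp
  have "R ^ t \<le> W / \<kappa>0 * q powr j"
    using hit(5) g_j_bound
    by (intro power_class_le[OF hit(1) slope_ge[OF hit(1-4) assms(2)]]) (auto simp: graded_def)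
  then have "R ^ t * q powr (- j) \<le> W / \<kappa>0 * q powr j * q powr (- j)"
    by (intro mult_right_mono) auto
  also have "\<dots> = W / \<kappa>0" using q_bounds by (simp add: powr_minus)
  finally have "4 * \<kappa> * R\<^sup>2 * G * (R ^ t * q powr (- j)) \<le> 4 * \<kappa> * R\<^sup>2 * G * (W / \<kappa>0)"
    using \<kappa>_bounds R_bounds G_bounds by (intro mult_left_mono) auto
  also have "\<dots> < 1"
  proof -
    have "2 * (4 * \<kappa> * R\<^sup>2 * G * W) \<le> \<kappa>0" using \<kappa>_mult_le_\<kappa>0 by (simp add: mult_ac)
    then have "4 * \<kappa> * R\<^sup>2 * G * W < \<kappa>0" using \<kappa>0_bounds by linarith
    then show ?thesis using \<kappa>0_bounds by (simp add: divide_less_eq)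
  qed
  finally show ?thesis by (simp add: crossing_error_def power_add power2_eq_square mult_ac)
qed

lemma crossing_height_le:
  assumes hits: "hit n t x q p r A B C" "hit n t x' q' p' r' A' B' C'"
  shows "\<bar>real_of_int (A * B' - A' * B)\<bar> \<le> crossing_scale / G ^ t * q"
proof -
  note hit = hitD[OF hits(1)] and hit' = hitD[OF hits(2)]
  define d d' where "d = of_int A + a * of_int B" and "d' = of_int A' + a * of_int B'"
  have q_bounds: "real_of_int q > 0" "real_of_int q' > 0" using hit hit' by auto
  have power: "q' powr s \<le> R * G * q powr s" if "0 \<le> s" "s \<le> 1" for s
    using powr_le_mult_powr[of q q' "R * G" s 1] q_bounds RG_ge_1 that
      graded_height_ratio[OF hit(1) hit'(1) hit(5) hit'(5)]
    by simp
  have "real_of_int (A * B' - A' * B) = d * B' - d' * B"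
    by (simp add: d_def d'_def algebra_simps)
  then have "\<bar>real_of_int (A * B' - A' * B)\<bar> \<le> \<bar>d\<bar> * \<bar>real_of_int B'\<bar> + \<bar>d'\<bar> * \<bar>real_of_int B\<bar>"
    by (simp flip: abs_mult)
  also have "\<dots> \<le> (W * q powr i / G ^ t) * (R * G * q powr j)
      + (W * (R * G * q powr i) / G ^ t) * q powr j"
  proof (intro add_mono mult_mono)
    show "\<bar>d\<bar> \<le> W * q powr i / G ^ t"
      using hit(5) G_bounds by (simp add: graded_def slope_def d_def le_divide_eq mult.commute)
    show "\<bar>real_of_int B'\<bar> \<le> R * G * q powr j"
      using power[of j] weights_bounds hit'(2) by (simp add: coeffs_le_def)
    have "\<bar>d'\<bar> \<le> W * q' powr i / G ^ t"
      using hit'(5) G_bounds by (simp add: graded_def slope_def d'_def le_divide_eq mult.commute)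
    also have "\<dots> \<le> W * (R * G * q powr i) / G ^ t"
      using power[of i] weights_bounds W_bounds G_bounds
      by (intro divide_right_mono mult_left_mono) auto
    finally show "\<bar>d'\<bar> \<le> W * (R * G * q powr i) / G ^ t" .
    show "\<bar>real_of_int B\<bar> \<le> q powr j" using hit(2) by (simp add: coeffs_le_def)
  qed (use W_bounds G_bounds R_bounds in auto)
  also have "\<dots> = crossing_scale / G ^ t * (q powr i * q powr j)"
    by (simp add: crossing_scale_def field_simps)
  also have "q powr i * q powr j = q" using q_bounds weights by (simp flip: powr_add)
  finally show ?thesis .
qed

lemma power_3_le_class_powr:
  assumes "j \<le> s"
  shows "R ^ (3 * t) \<le> (G ^ t) powr s"
proof -
  have "3 \<le> real g * s" using g_j_bound assms mult_left_mono[of j s "real g"] by simp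
  then have "R powr (real t * 3) \<le> R powr (real t * (real g * s))"
    using R_bounds by (intro powr_mono mult_left_mono) auto
  moreover have "G ^ t = R powr (real g * real t)"
    using R_bounds by (simp add: G_def powr_realpow[symmetric] powr_powr)
  ultimately show ?thesis
    using R_bounds by (simp add: powr_realpow[symmetric] powr_powr mult_ac)
qed

lemma crossing_height_powr_le:
  assumes hits: "hit n t x q p r A B C" "hit n t x' q' p' r' A' B' C'" and s_bounds: "j \<le> s" "s \<le> 1"
  shows "\<bar>real_of_int (A * B' - A' * B)\<bar> powr s \<le> crossing_scale / R ^ (3 * t) * q powr s"
proof -
  have q_bounds: "real_of_int q > 0" using hitD(1)[OF hits(1)] by simp
  have "\<bar>real_of_int (A * B' - A' * B)\<bar> powr s \<le> (crossing_scale / G ^ t * q) powr s"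
    using crossing_height_le[OF hits] s_bounds weights by (intro powr_mono2) auto
  also have "\<dots> = crossing_scale powr s / (G ^ t) powr s * q powr s"
    using crossing_scale_ge_1 G_bounds q_bounds by (simp add: powr_mult powr_divide)
  also have "\<dots> \<le> crossing_scale / R ^ (3 * t) * q powr s"
    using power_3_le_class_powr[OF s_bounds(1), of t] powr_mono[of s 1 crossing_scale]
      crossing_scale_ge_1 R_bounds s_bounds
    by (intro mult_right_mono frac_le) auto
  finally show ?thesis .
qed

lemma high_class_constants:
  assumes "t0 < t"
  shows "crossing_error t * crossing_scale \<le> c * R ^ (3 * t)"
    and "4 * W * R ^ 3 * G ^ 3 * \<kappa> * R ^ t \<le> \<rho> * R ^ (3 * t)"
proof -
  have t0_large': "32 * W ^ 2 * R ^ 11 * G ^ 3 \<le> R ^ t0"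
    using t0_large by (simp add: W_def G_def power_add mult_ac flip: power_mult)
  have dominated: "\<kappa> * (32 * W ^ 2 * R ^ 11 * G ^ 3 * R ^ t0 * R ^ t) \<le> \<kappa> * R ^ (3 * t)"
  proof (intro mult_left_mono)
    have "32 * W ^ 2 * R ^ 11 * G ^ 3 * R ^ t0 * R ^ t \<le> R ^ t0 * R ^ t0 * R ^ t"
      using t0_large' R_bounds by (intro mult_right_mono) auto
    also have "\<dots> = R ^ (t0 + t0 + t)" by (simp add: power_add)
    also have "\<dots> \<le> R ^ (3 * t)" using R_bounds assms by (intro power_increasing) auto
    finally show "32 * W ^ 2 * R ^ 11 * G ^ 3 * R ^ t0 * R ^ t \<le> R ^ (3 * t)" .
  qed (use \<kappa>_bounds in simp)
  have pos: "0 < W * R ^ (8 + t0)" using W_bounds R_bounds by simp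
  have "4 * (crossing_error t * crossing_scale) * (W * R ^ (8 + t0))
      = \<kappa> * (32 * W ^ 2 * R ^ 11 * G ^ 2 * R ^ t0 * R ^ t)"
    by (simp add: crossing_error_def crossing_scale_def power_add eval_nat_numeral)
  also have "\<dots> \<le> \<kappa> * (32 * W ^ 2 * R ^ 11 * G ^ 3 * R ^ t0 * R ^ t)"
    using \<kappa>_bounds W_bounds R_bounds G_bounds
    by (intro mult_left_mono mult_mono power_increasing) auto
  also have "\<dots> \<le> \<kappa> * R ^ (3 * t)" by (rule dominated)
  finally show "crossing_error t * crossing_scale \<le> c * R ^ (3 * t)"
    using pos by (simp add: c_def \<rho>_def pos_le_divide_eq)
  have "4 * W * R ^ 3 * G ^ 3 * \<kappa> * R ^ t * (W * R ^ (8 + t0))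
      = \<kappa> * (4 * W ^ 2 * R ^ 11 * G ^ 3 * R ^ t0 * R ^ t)"
    by (simp add: power_add eval_nat_numeral)
  also have "\<dots> \<le> \<kappa> * (32 * W ^ 2 * R ^ 11 * G ^ 3 * R ^ t0 * R ^ t)"
    using \<kappa>_bounds W_bounds R_bounds G_bounds by (intro mult_left_mono mult_right_mono) auto
  also have "\<dots> \<le> \<kappa> * R ^ (3 * t)" by (rule dominated)
  finally show "4 * W * R ^ 3 * G ^ 3 * \<kappa> * R ^ t \<le> \<rho> * R ^ (3 * t)"
    using pos by (simp add: \<rho>_def pos_le_divide_eq)
qed

lemma graded_height_le:
  assumes "1 \<le> q" "graded n t q D"
  shows "len n * q powr (1 + i) * W \<le> \<kappa> * R ^ t * R * G ^ Suc t"
proof -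
  have D_pos: "D > 0" by (rule graded_pos[OF assms])
  have "len n * (q * D) = R * (len (Suc n) * (q * D))" by (simp add: len_Suc[of n])
  also have "\<dots> \<le> R * (\<kappa> * R ^ (t - t0))"
    using assms(2) R_bounds by (intro mult_left_mono) (auto simp: graded_def)
  also have "\<dots> \<le> R * (\<kappa> * R ^ t)"
    using \<kappa>_bounds R_bounds by (intro mult_left_mono power_increasing) auto
  finally have "len n * (q * D) * (W * q powr i) \<le> R * (\<kappa> * R ^ t) * (G ^ Suc t * D)"
    by (rule mult_mono) (use assms W_bounds \<kappa>_bounds R_bounds in \<open>auto simp: graded_def\<close>)
  then have "(len n * (q * q powr i) * W) * D \<le> (\<kappa> * R ^ t * R * G ^ Suc t) * D"
    by (simp add: mult_ac)
  then show ?thesis using D_pos assms(1) by (simp add: powr_add)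
qed

lemma crossing_height_small:
  assumes hits: "hit n t x q p r A B C" "hit n t x' q' p' r' A' B' C'" and large_class: "t0 < t"
  shows "len n * \<bar>real_of_int (A * B' - A' * B)\<bar> powr (1 + i) \<le> \<rho>"
proof -
  note hit = hitD[OF hits(1)]
  define q0 where "q0 = \<bar>real_of_int (A * B' - A' * B)\<bar>"
  have "q0 powr (1 + i) = q0 * q0 powr i" by (simp add: q0_def powr_mult_base)
  also have "\<dots> \<le> (crossing_scale / G ^ t * q) * (crossing_scale / R ^ (3 * t) * q powr i)"
    using crossing_height_le[OF hits] crossing_height_powr_le[OF hits, of i] weights weights_bounds
    unfolding q0_def by (intro mult_mono) auto
  also have "\<dots> = crossing_scale\<^sup>2 / (G ^ t * R ^ (3 * t)) * q powr (1 + i)"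
    using hit(1) by (simp add: powr_add power2_eq_square)
  finally have "len n * q0 powr (1 + i)
      \<le> len n * (crossing_scale\<^sup>2 / (G ^ t * R ^ (3 * t)) * q powr (1 + i))"
    using len_pos[of n] by (intro mult_left_mono) auto
  also have "\<dots> = crossing_scale\<^sup>2 / (W * G ^ t * R ^ (3 * t)) * (len n * q powr (1 + i) * W)"
    using W_bounds by simp
  also have "\<dots> \<le> crossing_scale\<^sup>2 / (W * G ^ t * R ^ (3 * t)) * (\<kappa> * R ^ t * R * G ^ Suc t)"
    using graded_height_le[OF hit(1,5)] W_bounds G_bounds R_bounds by (intro mult_left_mono) auto
  also have "\<dots> = 4 * W * R ^ 3 * G ^ 3 * \<kappa> * R ^ t / R ^ (3 * t)"
    using W_bounds G_bounds by (simp add: crossing_scale_def eval_nat_numeral)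
  also have "\<dots> \<le> \<rho>"
    using high_class_constants(2)[OF large_class] R_bounds by (simp add: divide_le_eq)
  finally show ?thesis unfolding q0_def .
qed

text \<open>If the two lines cross, their intersection, read off from their cross product, is a rational
  point of smaller height that is near the current interval, so it was avoided earlier.\<close>

lemma crossing_is_near:
  assumes hits: "hit n t x q p r A B C" "hit n t x' q' p' r' A' B' C'"
    and "\<bar>x' - x\<bar> \<le> len n" "t0 < t"
    and crossing: "q0 = A * B' - A' * B" "q0 \<noteq> 0"
  shows "near i j c \<bar>q0\<bar> (of_int (sgn q0 * (B * C' - B' * C))) (of_int (sgn q0 * (A' * C - A * C')))
    x (a * x + b)"
proof -
  have q_bounds: "real_of_int q > 0" using hitD(1)[OF hits(1)] by simp
  have closer: "crossing_error t * q powr (- s) \<le> c * real_of_int \<bar>q0\<bar> powr (- s)"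
    if s_bounds: "j \<le> s" "s \<le> 1" for s
  proof -
    have "crossing_error t * real_of_int \<bar>q0\<bar> powr s
        \<le> crossing_error t * (crossing_scale / R ^ (3 * t) * q powr s)"
      using crossing_height_powr_le[OF hits s_bounds] crossing_error_pos[of t]
      unfolding crossing by (intro mult_left_mono) auto
    also have "\<dots> = crossing_error t * crossing_scale / R ^ (3 * t) * q powr s" by simp
    also have "\<dots> \<le> c * q powr s"
      using high_class_constants(1)[OF \<open>t0 < t\<close>] R_bounds
      by (intro mult_right_mono) (auto simp: divide_le_eq)
    finally show ?thesis using q_bounds crossing(2) by (simp add: powr_minus field_simps)
  qed
  show ?thesis
    unfolding near_of_int_sgn_iff[OF crossing(2)]
    using crossing_near[OF hits assms(3)] crossing(1) closer[of i] closer[of j]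
      weights weights_bounds
    by simp
qed

lemma parallel_of_high_class:
  assumes hits: "hit n t x q p r A B C" "hit n t x' q' p' r' A' B' C'"
    and clear: "clear_interval n v" and mem: "x \<in> {v..v + len n}" "x' \<in> {v..v + len n}"
    and large_class: "t0 < t"
  shows "A * B' = A' * B"
proof (rule ccontr)
  assume "\<not> ?thesis"
  then have "A * B' - A' * B \<noteq> 0" by simp
  moreover have "\<bar>x' - x\<bar> \<le> len n" using mem by auto
  ultimately have "\<rho> < len n * \<bar>A * B' - A' * B\<bar> powr (1 + i)"
    using height_gt_of_near[OF clear mem(1) _ crossing_is_near[OF hits _ large_class refl]] by simp
  then show False using crossing_height_small[OF hits large_class] by simp
qed

lemma close_of_high_class:
  assumes hits: "hit n t x q p r A B C" "hit n t x' q' p' r' A' B' C'"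
    and clear: "clear_interval n v" and mem: "x \<in> {v..v + len n}" "x' \<in> {v..v + len n}"
    and large_class: "t0 < t"
  shows "\<bar>x - x'\<bar> \<le> len (deadline n (Suc t))"
proof -
  have parallel: "A * B' = A' * B" by (rule parallel_of_high_class[OF hits clear mem large_class])
  have q_bounds: "real_of_int q \<ge> 1" using hitD(1)[OF hits(1)] by simp
  have "x \<in> {-X..X}" using clear mem start_subset unfolding clear_interval_def by blast
  then have less: "crossing_error t * q powr (- j) < 1"
    by (intro crossing_error_less_1[OF hits(1)]) auto
  have "crossing_error t * q powr (- i) \<le> crossing_error t * q powr (- j)"
    using q_bounds weights crossing_error_pos[of t] by (intro mult_left_mono powr_mono) auto
  moreover have "\<bar>x' - x\<bar> \<le> len n" using mem by auto
  moreover have "real_of_int A * B' - A' * B = 0" using parallel by (simp flip: of_int_mult)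
  ultimately have "\<bar>real_of_int (B * C' - B' * C)\<bar> < 1" "\<bar>real_of_int (A' * C - A * C')\<bar> < 1"
    using crossing_near[OF hits] less by simp_all
  then have "B * C' - B' * C = 0" "A' * C - A * C' = 0" by linarith+
  then show ?thesis using parallel by (intro close_of_same_line[OF hits]) auto
qed

subsection \<open>Inhomogeneous points\<close>

lemma shifted_constants:
  "2 * c' * R ^ 7 = \<rho>'" "R * (2 * c' + W * (R * \<rho>')) \<le> c" "R ^ 3 * \<rho>' \<le> \<rho>" "\<rho>' \<le> l" "c \<le> 1"
proof -
  show c'_eq: "2 * c' * R ^ 7 = \<rho>'" using R_bounds by (simp add: c'_def)
  have c_eq: "R ^ 3 * \<rho>' * (1 + W) = c" using R_bounds W_bounds by (simp add: \<rho>'_def)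
  have "2 * c' * 1 \<le> 2 * c' * R ^ 7" using constants_pos R_bounds by (intro mult_left_mono) auto
  then have "2 * c' + W * (R * \<rho>') \<le> 1 * \<rho>' + W * (R * \<rho>')" using c'_eq by simp
  also have "\<dots> \<le> R\<^sup>2 * \<rho>' + W * (R\<^sup>2 * \<rho>')"
  proof (intro add_mono mult_left_mono mult_right_mono)
    show "1 \<le> R\<^sup>2" using R_bounds by (intro one_le_power)
    show "R \<le> R\<^sup>2" using R_bounds by (simp add: power2_eq_square)
  qed (use constants_pos W_bounds in auto)
  finally have "R * (2 * c' + W * (R * \<rho>')) \<le> R * (R\<^sup>2 * \<rho>' + W * (R\<^sup>2 * \<rho>'))"
    using R_bounds by (intro mult_left_mono) auto
  also have "\<dots> = c" by (simp add: c_eq[symmetric] eval_nat_numeral algebra_simps)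
  finally show "R * (2 * c' + W * (R * \<rho>')) \<le> c" .
  have "R ^ 3 * \<rho>' * 1 \<le> R ^ 3 * \<rho>' * (1 + W)"
    using constants_pos R_bounds W_bounds by (intro mult_left_mono) auto
  then have cube_le: "R ^ 3 * \<rho>' \<le> c" using c_eq by simp
  then show "R ^ 3 * \<rho>' \<le> \<rho>" using constants_pos by (simp add: c_def)
  have "\<kappa> * 1 \<le> \<kappa> * (1 + \<bar>a\<bar>)" using \<kappa>_bounds by (intro mult_left_mono) auto
  also have "\<dots> \<le> l * \<kappa>0\<^sup>2" by (rule \<kappa>_bounds)
  also have "\<dots> \<le> l * 1" using l_pos \<kappa>0_bounds by (intro mult_left_mono) (auto simp: power_le_one)
  finally have "c \<le> l" using c_le_\<kappa> constants_pos by linarith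
  moreover have "1 * \<rho>' \<le> R ^ 3 * \<rho>'" using constants_pos R_bounds by (intro mult_right_mono) auto
  ultimately show "\<rho>' \<le> l" using cube_le by linarith
  have "1 * 1 * 1 * 1 \<le> 8 * R\<^sup>2 * G * W" using R_bounds G_bounds W_bounds by (intro mult_mono) auto
  then have "\<kappa> * 1 \<le> \<kappa> * (8 * R\<^sup>2 * G * W)" using \<kappa>_bounds by (intro mult_left_mono) auto
  then show "c \<le> 1" using \<kappa>_mult_le_\<kappa>0 \<kappa>0_bounds c_le_\<kappa> constants_pos by linarith
qed

lemma shifted_hitD:
  assumes "shifted_hit n x q p r"
  shows "1 \<le> q" "near i j c' q (p + \<gamma>) (r + \<delta>) x (a * x + b)"
    "len (Suc n) * q powr (1 + i) < \<rho>'" "\<rho>' \<le> len n * q powr (1 + i)"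
  using assms by (auto simp: shifted_hit_def)

lemma shifted_height_ratio:
  assumes "shifted_hit n x q p r" "shifted_hit n x' q' p' r'"
  shows "q' \<le> R * q"
proof (rule le_mult_of_powr_le)
  note hit = shifted_hitD[OF assms(1)] and hit' = shifted_hitD[OF assms(2)]
  have "len (Suc n) * q' powr (1 + i) \<le> len n * q powr (1 + i)" using hit(4) hit'(3) by linarith
  also have "\<dots> = len (Suc n) * (R * q powr (1 + i))" by (simp add: len_Suc[of n])
  finally show "q' powr (1 + i) \<le> R * q powr (1 + i)" using len_pos[of "Suc n"] by simp
  show "0 < real_of_int q" "0 < real_of_int q'" using hit hit' by auto
qed (use R_bounds weights_bounds in auto)

lemma shifted_hit_drift_le:
  assumes "shifted_hit n x q p r" "\<bar>x - y\<bar> \<le> len n"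
  shows "q * \<bar>x - y\<bar> \<le> R * \<rho>' * q powr (- i)"
proof -
  note hit = shifted_hitD[OF assms(1)]
  have q_bounds: "real_of_int q \<ge> 1" "q powr i > 0" using hit by auto
  have "q * \<bar>x - y\<bar> * q powr i \<le> q * len n * q powr i"
    using assms(2) q_bounds by (intro mult_right_mono mult_left_mono) auto
  also have "\<dots> = R * (len (Suc n) * q powr (1 + i))"
    using q_bounds by (simp add: len_Suc[of n] powr_add)
  also have "\<dots> \<le> R * \<rho>'" using hit(3) R_bounds by (intro mult_left_mono) auto
  finally show ?thesis using q_bounds by (simp add: powr_minus field_simps)
qed

lemma shifted_coordinate_difference_le:
  fixes z z' \<zeta> \<zeta>' s :: real
  assumes hits: "shifted_hit n x q p r" "shifted_hit n x' q' p' r'"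
    and "q \<le> q'" and dist_le: "\<bar>x - x'\<bar> \<le> len n"
    and near: "\<bar>q * z - \<zeta>\<bar> \<le> c' * q powr (- s)" "\<bar>q' * z' - \<zeta>'\<bar> \<le> c' * q' powr (- s)"
    and lipschitz: "\<bar>z - z'\<bar> \<le> W * \<bar>x - x'\<bar>" and s_bounds: "0 \<le> s" "s \<le> i"
  shows "\<bar>real_of_int (q' - q) * z' - (\<zeta>' - \<zeta>)\<bar> \<le> c / R * q powr (- s)"
proof -
  have q_bounds: "real_of_int q \<ge> 1" using shifted_hitD(1)[OF hits(1)] by simp
  have "c' * q' powr (- s) \<le> c' * q powr (- s)"
    using \<open>q \<le> q'\<close> q_bounds constants_pos s_bounds by (intro mult_left_mono powr_mono2') auto
  from shift_difference_le[OF near(1) order.trans[OF near(2) this]]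
  have "\<bar>real_of_int (q' - q) * z' - (\<zeta>' - \<zeta>)\<bar> \<le> 2 * (c' * q powr (- s)) + q * \<bar>z - z'\<bar>"
    using q_bounds by simp
  also have "\<dots> \<le> 2 * (c' * q powr (- s)) + W * (q * \<bar>x - x'\<bar>)"
    using mult_left_mono[OF lipschitz, of q] q_bounds by (simp add: mult.left_commute)
  also have "\<dots> \<le> 2 * (c' * q powr (- s)) + W * (R * \<rho>' * q powr (- s))"
  proof (intro add_left_mono mult_left_mono order.trans[OF shifted_hit_drift_le[OF _ dist_le]])
    show "q powr (- i) \<le> q powr (- s)" using q_bounds s_bounds by (intro powr_mono) auto
  qed (use hits R_bounds W_bounds constants_pos in auto)
  also have "\<dots> = (2 * c' + W * (R * \<rho>')) * q powr (- s)" by (simp add: algebra_simps)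
  also have "\<dots> \<le> c / R * q powr (- s)"
    using shifted_constants(2) R_bounds
    by (intro mult_right_mono) (auto simp: le_divide_eq mult.commute)
  finally show ?thesis .
qed

lemma shifted_hits_difference_near:
  assumes hits: "shifted_hit n x q p r" "shifted_hit n x' q' p' r'"
    and "q \<le> q'" "\<bar>x - x'\<bar> \<le> len n"
  shows "\<bar>real_of_int (q' - q) * x' - of_int (p' - p)\<bar> \<le> c / R * q powr (- i)"
    and "\<bar>real_of_int (q' - q) * (a * x' + b) - of_int (r' - r)\<bar> \<le> c / R * q powr (- j)"
proof -
  note near = shifted_hitD(2)[OF hits(1)] shifted_hitD(2)[OF hits(2)]
  have "1 * \<bar>x - x'\<bar> \<le> W * \<bar>x - x'\<bar>" using W_bounds by (intro mult_right_mono) auto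
  then show "\<bar>real_of_int (q' - q) * x' - of_int (p' - p)\<bar> \<le> c / R * q powr (- i)"
    using shifted_coordinate_difference_le[OF assms, of x "p + \<gamma>" i x' "p' + \<gamma>"] near weights_bounds
    unfolding near_def by simp
  have "\<bar>(a * x + b) - (a * x' + b)\<bar> = \<bar>a\<bar> * \<bar>x - x'\<bar>"
    by (simp flip: abs_mult right_diff_distrib)
  also have "\<dots> \<le> W * \<bar>x - x'\<bar>" by (intro mult_right_mono) (auto simp: W_def)
  finally show "\<bar>real_of_int (q' - q) * (a * x' + b) - of_int (r' - r)\<bar> \<le> c / R * q powr (- j)"
    using shifted_coordinate_difference_le[OF assms, of "a * x + b" "r + \<delta>" j "a * x' + b" "r' + \<delta>"]
      near weights
    unfolding near_def by simp
qed

text \<open>The difference of two inhomogeneous points is a homogeneous point, which was avoided earlier.\<close>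

lemma shifted_hits_height_le:
  assumes hits: "shifted_hit n x q p r" "shifted_hit n x' q' p' r'"
    and clear: "clear_interval n v" and mem: "x \<in> {v..v + len n}" "x' \<in> {v..v + len n}"
  shows "q' \<le> q"
proof (rule ccontr)
  assume "\<not> ?thesis"
  then have q_bounds: "1 \<le> q" "1 \<le> q' - q" "q \<le> q'" using shifted_hitD(1)[OF hits(1)] by auto
  have gap_le: "real_of_int (q' - q) \<le> R * q" using shifted_height_ratio[OF hits] q_bounds by simp
  have "q powr (- s) \<le> R * real_of_int (q' - q) powr (- s)" if "0 \<le> s" "s \<le> 1" for s
    using powr_le_mult_powr[OF _ _ gap_le, of s 1] R_bounds q_bounds that
    by (simp add: powr_minus field_simps)
  then have widen: "c / R * q powr (- s) \<le> c * real_of_int (q' - q) powr (- s)"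
    if "0 \<le> s" "s \<le> 1" for s
    using that R_bounds constants_pos by (simp add: pos_divide_le_eq mult_ac)
  have "\<bar>x - x'\<bar> \<le> len n" using mem by auto
  then have "near i j c (q' - q) (of_int (p' - p)) (of_int (r' - r)) x' (a * x' + b)"
    using shifted_hits_difference_near[OF hits q_bounds(3)] widen[of i] widen[of j] weights_bounds
    unfolding near_def by fastforce
  then have "\<rho> < len n * real_of_int (q' - q) powr (1 + i)"
    by (rule height_gt_of_near[OF clear mem(2) q_bounds(2)])
  also have "\<dots> \<le> len n * (R\<^sup>2 * q powr (1 + i))"
    using powr_le_mult_powr[OF _ _ gap_le, of "1 + i" 2] R_bounds q_bounds weights_bounds
      len_pos[of n]
    by (intro mult_left_mono) auto
  also have "\<dots> = R ^ 3 * (len (Suc n) * q powr (1 + i))"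
    by (simp add: len_Suc[of n] eval_nat_numeral)
  also have "\<dots> \<le> R ^ 3 * \<rho>'"
    using shifted_hitD(3)[OF hits(1)] R_bounds by (intro mult_left_mono) auto
  finally show False using shifted_constants(3) by simp
qed

lemma close_of_shifted_hits:
  assumes hits: "shifted_hit n x q p r" "shifted_hit n x' q' p' r'"
    and clear: "clear_interval n v" and mem: "x \<in> {v..v + len n}" "x' \<in> {v..v + len n}"
  shows "\<bar>x - x'\<bar> \<le> len (deadline n 0)"
proof -
  note hit = shifted_hitD[OF hits(1)] and hit' = shifted_hitD[OF hits(2)]
  have same_height: "q' = q"
    using shifted_hits_height_le[OF hits clear mem]
      shifted_hits_height_le[OF hits(2,1) clear mem(2,1)]
    by simp
  have q_bounds: "real_of_int q \<ge> 1" using hit by simp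
  have "c / R * q powr (- i) < 1"
  proof -
    have "c / R < 1" using shifted_constants(5) R_bounds by (simp add: divide_less_eq)
    moreover have "c / R * q powr (- i) \<le> c / R * q powr 0"
      using q_bounds weights_bounds constants_pos R_bounds by (intro mult_left_mono powr_mono) auto
    ultimately show ?thesis using q_bounds by simp
  qed
  moreover have "\<bar>x - x'\<bar> \<le> len n" using mem by auto
  ultimately have "\<bar>real_of_int (p' - p)\<bar> < 1"
    using shifted_hits_difference_near(1)[OF hits] same_height by simp
  then have same_numerator: "p' = p" by linarith
  have "q * \<bar>x - x'\<bar> = \<bar>(q * x - (p + \<gamma>)) - (q * x' - (p + \<gamma>))\<bar>"
    using q_bounds by (simp add: abs_mult flip: right_diff_distrib)
  also have "\<dots> \<le> 2 * c' * q powr (- i)"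
    using hit(2) hit'(2) unfolding near_def same_height same_numerator by linarith
  finally have "q * \<bar>x - x'\<bar> * q powr i \<le> 2 * c'"
    using q_bounds by (simp add: powr_minus field_simps)
  then have "\<bar>x - x'\<bar> * q powr (1 + i) * R ^ 7 \<le> 2 * c' * R ^ 7"
    using q_bounds R_bounds by (intro mult_right_mono) (auto simp: powr_add mult_ac)
  also have "\<dots> \<le> len (deadline n 0) * q powr (1 + i) * R ^ 7"
    unfolding shifted_constants(1) using hit(4) by (simp add: mult_ac flip: len_deadline[of n 0])
  finally show ?thesis using R_bounds q_bounds by simp
qed

lemma isolating_danger: "isolating u0 l (1/R) danger"
  unfolding isolating_def len_def[symmetric]
proof (intro allI impI ballI)
  fix n m v x x'
  assume "{v..v + len n} \<subseteq> {u0..u0 + l}" "cleared danger n {v..v + len n}"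
  then have clear: "clear_interval n v" by (simp add: clear_interval_def)
  assume "x \<in> danger n m \<inter> {v..v + len n}" "x' \<in> danger n m \<inter> {v..v + len n}"
  then have danger: "x \<in> danger n m" "x' \<in> danger n m"
    and mem: "x \<in> {v..v + len n}" "x' \<in> {v..v + len n}" by auto
  show "\<bar>x - x'\<bar> \<le> len (deadline n m)"
  proof (cases m)
    case 0
    then show ?thesis
      using danger close_of_shifted_hits[OF _ _ clear mem] by auto
  next
    case (Suc t)
    then obtain q p r A B C q' p' r' A' B' C'
      where hits: "hit n t x q p r A B C" "hit n t x' q' p' r' A' B' C'"
      using danger by auto
    have "\<bar>x - x'\<bar> \<le> len n" using mem by auto
    then show ?thesis
      using close_of_low_class[OF hits] close_of_high_class[OF hits clear mem] Suc
      by (cases "t \<le> t0") auto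
  qed
qed

lemma not_near_of_not_danger:
  assumes "\<And>n. x \<notin> danger n 0" "1 \<le> q"
  shows "\<not> near i j c' q (of_int p + \<gamma>) (of_int r + \<delta>) x (a * x + b)"
proof
  assume near: "near i j c' q (of_int p + \<gamma>) (of_int r + \<delta>) x (a * x + b)"
  have "l * 1 \<le> l * q powr (1 + i)"
    using assms(2) weights_bounds l_pos by (intro mult_left_mono ge_one_powr_ge_zero) auto
  then have "\<rho>' \<le> l * q powr (1 + i)" using shifted_constants(4) by simp
  then obtain n where "len (Suc n) * q powr (1 + i) < \<rho>'" "\<rho>' \<le> len n * q powr (1 + i)"
    using level_exists constants_pos by blast
  then have "shifted_hit n x q p r" using near assms(2) by (simp add: shifted_hit_def)
  then have "x \<in> danger n 0" by auto
  then show False using assms(1) by blast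
qed

lemma Bad_of_not_danger:
  assumes "\<And>n m. x \<notin> danger n m"
  shows "(x, a * x + b) \<in> Bad (\<gamma>, \<delta>) i j"
  using weights_bounds(1) weights(1) constants_pos(4) not_near_of_not_danger[OF assms]
  by (rule BadI)

end

section \<open>The winning property\<close>

lemma dangerous_sets_exist:
  fixes i j a b \<epsilon> u l R :: real
  assumes weights: "0 < j" "j \<le> i" "i + j = 1" and transversal: "transversal i j a b \<epsilon>" "\<epsilon> > 0"
    and R_ge_4: "R \<ge> 4" and l_pos: "l > 0"
  obtains X \<kappa>0 c0 \<kappa> g t0 where "dangerous_sets i j a b u l R X \<kappa>0 c0 \<epsilon> \<kappa> g t0"
proof -
  define X where "X = \<bar>u\<bar> + l"
  have "X > 0" unfolding X_def using l_pos by simp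
  then obtain \<kappa>1 c0 where \<kappa>1_c0_pos: "\<kappa>1 > 0" "c0 > 0"
    and transversal_X: "transversal_on i j a b \<epsilon> X \<kappa>1 c0"
    using transversal(1) unfolding transversal_def by blast
  define \<kappa>0 where "\<kappa>0 = min 1 \<kappa>1"
  have \<kappa>0_bounds: "0 < \<kappa>0" "\<kappa>0 \<le> 1" unfolding \<kappa>0_def using \<kappa>1_c0_pos by auto
  have transversal_\<kappa>0: "transversal_on i j a b \<epsilon> X \<kappa>0 c0"
    using transversal_X order.trans[OF mult_right_mono[of \<kappa>0 \<kappa>1]]
    unfolding transversal_on_def \<kappa>0_def by (meson min.cobounded2 powr_ge_zero)
  define g where "g = nat \<lceil>max (2/\<epsilon>) (3/j)\<rceil>"
  have "real g \<ge> max (2/\<epsilon>) (3/j)" unfolding g_def by linarith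
  then have g_bounds: "2 \<le> real g * \<epsilon>" "3 \<le> real g * j"
    using transversal(2) weights by (auto simp: pos_divide_le_eq)
  define V where "V = 8 * R\<^sup>2 * R ^ g * (1 + \<bar>a\<bar>)"
  define \<kappa> where "\<kappa> = min (min (l * \<kappa>0\<^sup>2 / (1 + \<bar>a\<bar>)) (\<kappa>0 / V)) c0"
  have V_pos: "0 < V" unfolding V_def using R_ge_4 by (intro mult_pos_pos) auto
  have "\<kappa> \<le> \<kappa>0 / V" "\<kappa> \<le> l * \<kappa>0\<^sup>2 / (1 + \<bar>a\<bar>)" "\<kappa> \<le> c0" by (simp_all add: \<kappa>_def)
  moreover have "0 < \<kappa>"
    unfolding \<kappa>_def using l_pos \<kappa>0_bounds \<kappa>1_c0_pos V_pos by (auto intro!: divide_pos_pos)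
  ultimately have \<kappa>_bounds: "0 < \<kappa>" "\<kappa> \<le> c0" "\<kappa> * (1 + \<bar>a\<bar>) \<le> l * \<kappa>0\<^sup>2" "\<kappa> * V \<le> \<kappa>0"
    using V_pos by (simp_all add: pos_le_divide_eq add_pos_nonneg)
  obtain t0 where "32 * (1 + \<bar>a\<bar>)\<^sup>2 * R ^ (11 + 3 * g) < R ^ t0"
    using real_arch_pow[of R] R_ge_4 by auto
  moreover have "{u..u + l} \<subseteq> {-X..X}" unfolding X_def by auto
  ultimately have "dangerous_sets i j a b u l R X \<kappa>0 c0 \<epsilon> \<kappa> g t0"
    using weights l_pos R_ge_4 \<kappa>0_bounds transversal_\<kappa>0 transversal(2) g_bounds \<kappa>_bounds
    unfolding V_def by unfold_locales auto
  then show ?thesis by (rule that)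
qed

lemma isolating_family_exists:
  fixes i j a b \<epsilon> \<gamma> \<delta> \<beta> u l :: real
  assumes weights: "0 < j" "j \<le> i" "i + j = 1" and transversal: "transversal i j a b \<epsilon>" "\<epsilon> > 0"
    and \<beta>_bounds: "0 < \<beta>" "\<beta> < 1" and l_pos: "l > 0"
  obtains E where "isolating u l (\<beta>/4) E"
    "\<And>x. (\<And>k m. x \<notin> E k m) \<Longrightarrow> (x, a * x + b) \<in> Bad (\<gamma>, \<delta>) i j"
proof -
  have "4 / \<beta> \<ge> 4" using \<beta>_bounds by (simp add: le_divide_eq)
  then obtain X \<kappa>0 c0 \<kappa> g t0 where "dangerous_sets i j a b u l (4/\<beta>) X \<kappa>0 c0 \<epsilon> \<kappa> g t0"
    using dangerous_sets_exist[OF weights transversal _ l_pos] by blast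
  then interpret dangerous_sets i j a b \<gamma> \<delta> u l "4/\<beta>" X \<kappa>0 c0 \<epsilon> \<kappa> g t0 .
  show ?thesis using that[of danger] isolating_danger Bad_of_not_danger by simp
qed

lemma alpha_winning_line_of_transversal:
  fixes i j a b \<epsilon> \<gamma> \<delta> :: real and p w :: "real \<times> real"
  assumes "0 < j" "j \<le> i" "i + j = 1" "transversal i j a b \<epsilon>" "\<epsilon> > 0" "w \<noteq> 0"
    and in_X: "\<And>x. (x, a * x + b) \<in> Bad (\<gamma>, \<delta>) i j \<Longrightarrow> p + x *\<^sub>R w \<in> X"
  shows "alpha_winning (range (\<lambda>t. p + t *\<^sub>R w)) (1/4) X"
proof -
  interpret affine_line p w using \<open>w \<noteq> 0\<close> by unfold_locales
  have "alpha_winning (range point) (1/4) X"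
  proof (rule alpha_winning_of_isolating)
    fix \<beta> u l :: real assume "0 < \<beta>" "\<beta> < 1" "l > 0"
    then obtain E where "isolating u l (\<beta>/4) E"
      "\<And>x. (\<And>k m. x \<notin> E k m) \<Longrightarrow> (x, a * x + b) \<in> Bad (\<gamma>, \<delta>) i j"
      using isolating_family_exists[OF assms(1-5)] by blast
    then show "\<exists>E. isolating u l (\<beta>/4) E \<and> (\<forall>x\<in>{u..u + l}. (\<forall>k m. x \<notin> E k m) \<longrightarrow> point x \<in> X)"
      using in_X unfolding point_def by blast
  qed
  then show ?thesis unfolding point_def .
qed

lemma plane_line_eq_range: "plane_line a b = range (\<lambda>x. (0, b) + x *\<^sub>R (1, a))"
  by (auto simp: plane_line_def)

lemma plane_line_eq_range_swap:
  assumes "a \<noteq> 0"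
  shows "plane_line a b = range (\<lambda>y. (- b/a, 0) + y *\<^sub>R (1/a, 1))"
proof -
  have "(x, y) \<in> plane_line a b \<longleftrightarrow> x = - b/a + y * (1/a)" for x y
    using assms by (auto simp: plane_line_def field_simps)
  then show ?thesis by auto
qed

lemma winning_of_transversal:
  fixes i j a b \<epsilon> :: real
  assumes weights: "0 < i" "0 < j" "i + j = 1" and a_nonzero: "a \<noteq> 0"
    and transversal: "transversal i j a b \<epsilon>" "\<epsilon> > 0"
  shows "winning (plane_line a b) (Bad \<theta> i j \<inter> plane_line a b)"
proof -
  obtain \<gamma> \<delta> where \<theta>_eq: "\<theta> = (\<gamma>, \<delta>)" by (cases \<theta>)
  have "alpha_winning (plane_line a b) (1/4) (Bad \<theta> i j \<inter> plane_line a b)"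
  proof (cases "j \<le> i")
    case True
    have "(0, b) + x *\<^sub>R (1, a) \<in> Bad \<theta> i j \<inter> plane_line a b"
      if "(x, a * x + b) \<in> Bad (\<gamma>, \<delta>) i j" for x
      using that by (simp add: \<theta>_eq plane_line_def add.commute mult.commute)
    then show ?thesis
      unfolding plane_line_eq_range[of a b]
      by (intro alpha_winning_line_of_transversal[OF weights(2) True weights(3) transversal])
        (auto simp: zero_prod_def)
  next
    case False
    then have swapped_weights: "i \<le> j" "j + i = 1" using weights by auto
    have swapped_transversal: "transversal j i (1/a) (- b/a) \<epsilon>"
      by (rule transversal_swap[OF a_nonzero transversal(1)])
    have "(- b/a, 0) + y *\<^sub>R (1/a, 1) \<in> Bad \<theta> i j \<inter> plane_line a b"
      if "(y, 1/a * y + - b/a) \<in> Bad (\<delta>, \<gamma>) j i" for y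
      using that a_nonzero Bad_swap[of y "1/a * y + - b/a"]
      by (simp add: \<theta>_eq plane_line_def field_simps)
    then show ?thesis
      unfolding plane_line_eq_range_swap[OF a_nonzero]
      by (intro alpha_winning_line_of_transversal[OF weights(1) swapped_weights
            swapped_transversal transversal(2)]) (auto simp: zero_prod_def)
  qed
  then show ?thesis unfolding winning_def by (intro conjI exI[of _ "1/4"]) auto
qed

theorem theorem2:
  fixes i j \<sigma> a b :: real
  assumes "0 < i" "i < 1" "0 < j" "j < 1" "i + j = 1"
    and "\<sigma> = min i j"
    and "a \<noteq> 0"
  shows "((\<exists>\<epsilon>>0. liminf (\<lambda>q::nat. ereal (real q powr (1 / \<sigma> - \<epsilon>) *
              max (dist_int (real q * a)) (dist_int (real q * b)))) > 0) \<longrightarrow>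
            (\<forall>\<theta>. winning (plane_line a b) (Bad \<theta> i j \<inter> plane_line a b))) \<and>
         (a \<in> \<rat> \<longrightarrow>
            liminf (\<lambda>q::nat. ereal (real q powr (1 / \<sigma>) *
              max (dist_int (real q * a)) (dist_int (real q * b)))) > 0 \<longrightarrow>
            (\<forall>\<theta>. winning (plane_line a b) (Bad \<theta> i j \<inter> plane_line a b)))"
  unfolding joint_dist_int_def[symmetric] assms(6)
proof (intro conjI impI allI)
  note winning = winning_of_transversal[OF assms(1,3,5,7)]
  fix \<theta> :: "real \<times> real"
  show "winning (plane_line a b) (Bad \<theta> i j \<inter> plane_line a b)"
    if "\<exists>\<epsilon>>0. liminf (\<lambda>q. ereal (real q powr (1 / min i j - \<epsilon>) * joint_dist_int a b q)) > 0"
  proof -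
    from that obtain \<epsilon> where \<epsilon>_bounds: "\<epsilon> > 0"
      and lim: "liminf (\<lambda>q. ereal (real q powr (1 / min i j - \<epsilon>) * joint_dist_int a b q)) > 0"
      by blast
    have "transversal i j a b (min \<epsilon> 1 * min i j)"
      using \<epsilon>_bounds lim by (intro transversal_of_liminf[OF assms(1,3,5,7)]) auto
    then show ?thesis by (rule winning) (use \<epsilon>_bounds assms(1,3) in auto)
  qed
  show "winning (plane_line a b) (Bad \<theta> i j \<inter> plane_line a b)"
    if "a \<in> \<rat>" and "liminf (\<lambda>q. ereal (real q powr (1 / min i j) * joint_dist_int a b q)) > 0"
  proof -
    have "transversal i j a b (min 0 1 * min i j)"
      using that(2) by (intro transversal_of_liminf[OF assms(1,3,5,7)]) auto
    then show ?thesis using winning[OF transversal_rational[OF that(1)]] by simp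
  qed
qed

end
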